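(* There exist a constant $c>0$ and $n_0$ such that for all $n\ge n_0$, the logarithm of the number of designs in $S(3,\{4,6\},2n)$ on a fixed $2n$-element set is greater than $c\,n^3\ln n$.
   Context: $S(3,\{4,6\},v)$ denotes the set of $3$-wise balanced designs on a $v$-element set $X$ with all blocks of size $4$ or $6$: collections of $4$- and $6$-element subsets of $X$ (blocks) such that every $3$-element subset of $X$ is contained in exactly one block. *)

theory Defs
  imports Complex_Main
begin

definition is_S3_46 :: "'a set \<Rightarrow> 'a set set \<Rightarrow> bool" where
  "is_S3_46 X \<B> \<longleftrightarrow>
     (\<forall>B\<in>\<B>. B \<subseteq> X \<and> (card B = 4 \<or> card B = 6)) \<and>
     (\<forall>T. T \<subseteq> X \<and> card T = 3 \<longrightarrow> (\<exists>!B. B \<in> \<B> \<and> T \<subseteq> B))"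

definition S3_46 :: "'a set \<Rightarrow> 'a set set set" where
  "S3_46 X = {\<B>. is_S3_46 X \<B>}"

end

theory Submission
  imports Defs "HOL-Library.FuncSet"
begin

text \<open>
  Doubling: replace every point of an \<open>S(3,{4,6},m)\<close> by a pair of points. A triple meeting three
  pairs lies over a block of the base design, so on each block one needs a system covering the
  transversal triples of 4 or 6 pairs exactly once; the remaining triples are covered by the unions
  of two pairs. If one point of the base design is deleted first, then the truncated blocks (of size
  3 or 5) together cover every pair of base points once, and the 6 or 10 points over a truncated
  block receive a full design. Hence \<open>S(3,{4,6},2n)\<close> arises from \<open>m = n\<close> or \<open>m = n + 1\<close>,
  whichever is even.

  The doubling can be done so that the designs contain, on a positive proportion \<open>4q\<close> of the points
  with \<open>q = 2^k\<close>, all the blocks \<open>{a, q + b, 2q + c, 3q + (a XOR b XOR c)}\<close>. These may be exchanged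
  for the graph of any other Latin cube of order \<open>q\<close>. For every direction \<open>v\<close>, the XOR cube contains
  many subcubes of order 2, with side \<open>{a, a XOR v}\<close> in each coordinate, and adding \<open>v\<close> to the entries
  of such a subcube yields another Latin cube. Choosing greedily, on a positive proportion of the
  cells, one of about \<open>q\<close> directions so that the subcubes stay disjoint gives \<open>exp (c q^3 ln q)\<close>
  Latin cubes.
\<close>

unbundle bit_operations_syntax

section \<open>Exact covers of families of triples\<close>

text \<open>No ambient point set is fixed: a cover is tied only to its family of triples, and no
  block may contain a foreign triple. In this form partial systems, such as those on transversal
  triples, can be glued and exchanged.\<close>

definition exact_cover :: "'a set set \<Rightarrow> 'a set set \<Rightarrow> bool" where
  "exact_cover \<B> \<T> \<longleftrightarrow>
     (\<forall>T\<in>\<T>. card T = 3 \<and> (\<exists>!B. B \<in> \<B> \<and> T \<subseteq> B)) \<and>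
     (\<forall>B\<in>\<B>. (card B = 4 \<or> card B = 6) \<and> (\<forall>T. T \<subseteq> B \<and> card T = 3 \<longrightarrow> T \<in> \<T>))"

definition triples :: "'a set \<Rightarrow> 'a set set" where
  "triples X = {T. T \<subseteq> X \<and> card T = 3}"

lemma exact_coverI:
  assumes "\<And>T. T \<in> \<T> \<Longrightarrow> card T = 3"
    and "\<And>T. T \<in> \<T> \<Longrightarrow> \<exists>!B. B \<in> \<B> \<and> T \<subseteq> B"
    and "\<And>B. B \<in> \<B> \<Longrightarrow> card B = 4 \<or> card B = 6"
    and "\<And>B T. B \<in> \<B> \<Longrightarrow> T \<subseteq> B \<Longrightarrow> card T = 3 \<Longrightarrow> T \<in> \<T>"
  shows "exact_cover \<B> \<T>"
  using assms unfolding exact_cover_def by auto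

lemma exact_coverD:
  assumes "exact_cover \<B> \<T>"
  shows "T \<in> \<T> \<Longrightarrow> card T = 3"
    and "T \<in> \<T> \<Longrightarrow> \<exists>!B. B \<in> \<B> \<and> T \<subseteq> B"
    and "B \<in> \<B> \<Longrightarrow> card B = 4 \<or> card B = 6"
    and "B \<in> \<B> \<Longrightarrow> T \<subseteq> B \<Longrightarrow> card T = 3 \<Longrightarrow> T \<in> \<T>"
  using assms unfolding exact_cover_def by auto

lemma exact_cover_ex:
  assumes "exact_cover \<B> \<T>" "T \<in> \<T>"
  shows "\<exists>B\<in>\<B>. T \<subseteq> B"
  using ex1_implies_ex[OF exact_coverD(2)[OF assms]] by blast

lemma exact_cover_unique:
  assumes "exact_cover \<B> \<T>" "T \<in> \<T>" and "B \<in> \<B>" "T \<subseteq> B" "B' \<in> \<B>" "T \<subseteq> B'"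
  shows "B = B'"
  by (rule ex1E[OF exact_coverD(2)[OF assms(1,2)]]) (use assms(3-) in metis)

lemma in_triple_of_block:
  assumes "card B = 4 \<or> card B = 6" "x \<in> B"
  obtains T where "T \<subseteq> B" "card T = 3" "x \<in> T"
proof -
  have f: "finite B" using assms card.infinite by fastforce
  have "2 \<le> card (B - {x})" using assms f by auto
  then obtain S where S: "S \<subseteq> B - {x}" "card S = 2" "finite S"
    by (rule obtain_subset_with_card_n)
  show ?thesis
  proof (rule that[of "insert x S"])
    have "x \<notin> S" using S by blast
    then show "card (insert x S) = 3" using S by simp
  qed (use S assms in auto)
qed

text \<open>A cover does not state that its blocks lie in \<open>X\<close>. It follows because each
  point of a block of size 4 or 6 is in some triple of that block, and this triple lies in
  \<open>X\<close>.\<close>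

lemma is_S3_46_iff_exact_cover: "is_S3_46 X \<B> \<longleftrightarrow> exact_cover \<B> (triples X)"
proof
  assume D: "is_S3_46 X \<B>"
  show "exact_cover \<B> (triples X)"
  proof (rule exact_coverI)
    show "\<exists>!B. B \<in> \<B> \<and> T \<subseteq> B" if "T \<in> triples X" for T
      using D that by (simp add: is_S3_46_def triples_def)
    show "T \<in> triples X" if "B \<in> \<B>" "T \<subseteq> B" "card T = 3" for B T
    proof -
      have "B \<subseteq> X" using D that(1) by (simp add: is_S3_46_def)
      then show ?thesis using that by (auto simp: triples_def)
    qed
  qed (use D in \<open>auto simp: is_S3_46_def triples_def\<close>)
next
  assume E: "exact_cover \<B> (triples X)"
  have "B \<subseteq> X" if "B \<in> \<B>" for B
  proof
    fix x assume "x \<in> B"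
    then obtain T where "T \<subseteq> B" "card T = 3" "x \<in> T"
      using in_triple_of_block[OF exact_coverD(3)[OF E \<open>B \<in> \<B>\<close>]] by blast
    then have "T \<in> triples X" using exact_coverD(4)[OF E \<open>B \<in> \<B>\<close>] by blast
    then show "x \<in> X" using \<open>x \<in> T\<close> by (auto simp: triples_def)
  qed
  then show "is_S3_46 X \<B>"
    using E by (simp add: is_S3_46_def exact_cover_def triples_def)
qed

text \<open>A block of part \<open>j\<close> containing a triple of part \<open>i\<close> would put
  this triple into both families, so disjoint families cannot interfere.\<close>

lemma exact_cover_UN:
  assumes E: "\<And>i. i \<in> I \<Longrightarrow> exact_cover (\<B> i) (\<T> i)"
    and disj: "\<And>i j T. i \<in> I \<Longrightarrow> j \<in> I \<Longrightarrow> T \<in> \<T> i \<Longrightarrow> T \<in> \<T> j \<Longrightarrow> i = j"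
  shows "exact_cover (\<Union>i\<in>I. \<B> i) (\<Union>i\<in>I. \<T> i)"
proof (rule exact_coverI)
  fix T assume "T \<in> (\<Union>i\<in>I. \<T> i)"
  then obtain i where i: "i \<in> I" "T \<in> \<T> i" by blast
  note Ei = exact_coverD[OF E[OF i(1)]]
  show 3: "card T = 3" using Ei(1) i by blast
  obtain B where B: "B \<in> \<B> i" "T \<subseteq> B" and u: "\<And>B'. B' \<in> \<B> i \<Longrightarrow> T \<subseteq> B' \<Longrightarrow> B' = B"
    using Ei(2)[OF i(2)] by blast
  show "\<exists>!B. B \<in> (\<Union>i\<in>I. \<B> i) \<and> T \<subseteq> B"
  proof (rule ex1I[of _ B])
    fix B' assume B': "B' \<in> (\<Union>i\<in>I. \<B> i) \<and> T \<subseteq> B'"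
    then obtain j where j: "j \<in> I" "B' \<in> \<B> j" by blast
    have "T \<in> \<T> j" using exact_coverD(4)[OF E[OF j(1)] j(2)] B' 3 by blast
    then have "j = i" using disj i j by blast
    then show "B' = B" using u B' j by blast
  qed (use B i in auto)
next
  fix B assume "B \<in> (\<Union>i\<in>I. \<B> i)"
  then show "card B = 4 \<or> card B = 6" using exact_coverD(3)[OF E] by auto
next
  fix B T assume "B \<in> (\<Union>i\<in>I. \<B> i)" "T \<subseteq> B" "card T = 3"
  then show "T \<in> (\<Union>i\<in>I. \<T> i)" using exact_coverD(4)[OF E] by blast
qed

text \<open>The triples in \<T>' are already covered by \<A>, so no other block of \<B> contains one
  of them, and \<A>' can take over.\<close>

lemma exact_cover_trade:
  assumes E: "exact_cover \<B> \<T>" and A: "exact_cover \<A> \<T>'" and A': "exact_cover \<A>' \<T>'"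
    and sub: "\<A> \<subseteq> \<B>"
  shows "exact_cover (\<B> - \<A> \<union> \<A>') \<T>"
proof (rule exact_coverI)
  fix T assume T: "T \<in> \<T>"
  show 3: "card T = 3" using exact_coverD(1)[OF E T] .
  obtain B where B: "B \<in> \<B>" "T \<subseteq> B" and uB: "\<And>B'. B' \<in> \<B> \<Longrightarrow> T \<subseteq> B' \<Longrightarrow> B' = B"
    using exact_coverD(2)[OF E T] by blast
  show "\<exists>!B. B \<in> \<B> - \<A> \<union> \<A>' \<and> T \<subseteq> B"
  proof (cases "T \<in> \<T>'")
    case True
    have "B \<in> \<A>" using exact_coverD(2)[OF A True] sub uB by blast
    then show ?thesis using exact_coverD(2)[OF A' True] uB by blast
  next
    case False
    then have "B \<notin> \<A>" using exact_coverD(4)[OF A _ B(2) 3] by blast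
    moreover have "\<not> T \<subseteq> B'" if "B' \<in> \<A>'" for B'
      using exact_coverD(4)[OF A' that _ 3] False by blast
    ultimately show ?thesis using B uB by blast
  qed
next
  fix B assume "B \<in> \<B> - \<A> \<union> \<A>'"
  then show "card B = 4 \<or> card B = 6" using exact_coverD(3)[OF E] exact_coverD(3)[OF A'] by blast
next
  fix B T assume B: "B \<in> \<B> - \<A> \<union> \<A>'" "T \<subseteq> B" "card T = 3"
  show "T \<in> \<T>"
  proof (cases "B \<in> \<B>")
    case True
    then show ?thesis using exact_coverD(4)[OF E] B by blast
  next
    case False
    then have "T \<in> \<T>'" using exact_coverD(4)[OF A'] B by blast
    then obtain A where "A \<in> \<A>" "T \<subseteq> A" using exact_coverD(2)[OF A] by blast
    then show ?thesis using exact_coverD(4)[OF E] sub B by blast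
  qed
qed

text \<open>This carries the explicit systems to arbitrary points. The predicates \<open>P\<close>
  and \<open>Q\<close> admit both full designs and covers of the transversal triples only.\<close>

lemma exact_cover_image:
  assumes E: "exact_cover \<B> (triples X \<inter> Collect P)" and inj: "inj_on f X"
    and P: "\<And>T. T \<subseteq> X \<Longrightarrow> Q (f ` T) \<longleftrightarrow> P T"
    and BX: "\<And>B. B \<in> \<B> \<Longrightarrow> B \<subseteq> X"
  shows "exact_cover ((`) f ` \<B>) (triples (f ` X) \<inter> Collect Q)"
proof -
  have *: "\<exists>T0. T0 \<subseteq> X \<and> T = f ` T0 \<and> card T0 = card T" if "T \<subseteq> f ` X" for T
    using that inj by (metis card_image inj_on_subset subset_imageE)
  have sub: "f ` S \<subseteq> f ` B \<longleftrightarrow> S \<subseteq> B" if "S \<subseteq> X" "B \<in> \<B>" for S B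
    using inj_on_image_mem_iff[OF inj] BX[OF that(2)] that(1) by blast
  show ?thesis
  proof (rule exact_coverI)
    fix T assume T: "T \<in> triples (f ` X) \<inter> Collect Q"
    then show "card T = 3" by (simp add: triples_def)
    obtain T0 where T0: "T0 \<subseteq> X" "T = f ` T0" "card T0 = 3"
      using *[of T] T unfolding triples_def by fastforce
    then have "T0 \<in> triples X \<inter> Collect P" using T P[of T0] by (simp add: triples_def)
    then have "\<exists>!B. B \<in> \<B> \<and> T0 \<subseteq> B" using exact_coverD(2)[OF E] by blast
    then show "\<exists>!B. B \<in> (`) f ` \<B> \<and> T \<subseteq> B"
      unfolding T0(2) using sub[OF T0(1)] by blast
  next
    fix B assume "B \<in> (`) f ` \<B>"
    then obtain B0 where "B0 \<in> \<B>" "B = f ` B0" by blast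
    then have "card B = card B0" using BX inj by (simp add: card_image inj_on_subset)
    then show "card B = 4 \<or> card B = 6" using exact_coverD(3)[OF E \<open>B0 \<in> \<B>\<close>] by simp
  next
    fix B T assume B: "B \<in> (`) f ` \<B>" and TB: "T \<subseteq> B" and 3: "card T = 3"
    then obtain B0 where B0: "B0 \<in> \<B>" "B = f ` B0" by blast
    then have "T \<subseteq> f ` X" using TB BX by blast
    then obtain T0 where T0: "T0 \<subseteq> X" "T = f ` T0" "card T0 = 3" using *[of T] 3 by auto
    then have "T0 \<subseteq> B0" using sub B0 TB by blast
    then have "T0 \<in> triples X \<inter> Collect P" by (rule exact_coverD(4)[OF E B0(1) _ T0(3)])
    then show "T \<in> triples (f ` X) \<inter> Collect Q"
      using T0 3 P[of T0] by (auto simp: triples_def)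
  qed
qed

lemma sorted_triple:
  fixes T :: "'a::linorder set"
  assumes "card T = 3"
  obtains a b c where "T = {a, b, c}" "a < b" "b < c"
proof -
  obtain x y z where "T = {x, y, z}" "x \<noteq> y" "y \<noteq> z" "x \<noteq> z"
    using assms by (auto simp: card_3_iff)
  then consider "x<y" "y<z" | "x<z" "z<y" | "y<x" "x<z" | "y<z" "z<x" | "z<x" "x<y" | "z<y" "y<x"
    by (meson linorder_neqE)
  then show thesis using that \<open>T = {x, y, z}\<close> by cases (auto simp: insert_commute)
qed

lemma ex1_if_filter_singleton:
  assumes "length (filter P xs) = 1"
  shows "\<exists>!x. x \<in> set xs \<and> P x"
proof -
  obtain y where "filter P xs = [y]" using assms by (auto simp: length_Suc_conv)
  then have "x \<in> set xs \<and> P x \<longleftrightarrow> x = y" for x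
    by (metis (mono_tags) empty_iff filter_set list.set(1,2) mem_Collect_eq set_filter insert_iff)
  then show ?thesis by auto
qed

text \<open>The points \<open>2 i\<close> and \<open>2 i + 1\<close> form the pair with index \<open>i = x div 2\<close>.\<close>

definition dbl :: "nat set \<Rightarrow> nat set" where
  "dbl Y = {x. x div 2 \<in> Y}"

definition transversal :: "nat set \<Rightarrow> bool" where
  "transversal U \<longleftrightarrow> inj_on (\<lambda>x. x div 2) U"

lemma dbl_eq: "dbl Y = (*) 2 ` Y \<union> (\<lambda>i. 2 * i + 1) ` Y"
proof -
  have "x \<in> (*) 2 ` Y \<union> (\<lambda>i. 2 * i + 1) ` Y" if "x div 2 \<in> Y" for x
    using that by (cases "even x") (auto simp: image_iff elim!: evenE oddE)
  then show ?thesis by (auto simp: dbl_def)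
qed

lemma dbl_lessThan: "dbl {..<n} = {..<2 * n}"
  by (auto simp: dbl_def)

lemma card_dbl: "card (dbl Y) = 2 * card Y"
proof (cases "finite Y")
  case True
  have "(*) 2 ` Y \<inter> (\<lambda>i::nat. 2 * i + 1) ` Y = {}" by auto presburger
  then have "card (dbl Y) = card ((*) 2 ` Y) + card ((\<lambda>i. 2 * i + 1) ` Y)"
    unfolding dbl_eq using True by (simp add: card_Un_disjoint)
  then show ?thesis by (simp add: card_image inj_on_def)
next
  case False
  then have "infinite ((*) 2 ` Y)" by (simp add: finite_image_iff inj_on_def)
  then show ?thesis using False by (simp add: dbl_eq)
qed

lemma finite_dbl: "finite Y \<Longrightarrow> finite (dbl Y)"
  by (simp add: dbl_eq)

section \<open>Designs over single blocks\<close>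

text \<open>The cyclic \<open>SQS(10)\<close> with base blocks \<open>{0,1,3,4}, {0,1,2,6}, {0,2,4,7}\<close>, with the points 2
  and 4 swapped so that \<open>{0,1,2,3}\<close> becomes a block.\<close>

definition sqs10 :: "nat list list" where
  "sqs10 = [[0,1,2,3], [0,1,4,6], [0,1,5,9], [0,1,7,8], [0,2,4,7], [0,2,5,6], [0,2,8,9], [0,3,4,9],
   [0,3,5,7], [0,3,6,8], [0,4,5,8], [0,6,7,9], [1,2,4,5], [1,2,6,8], [1,2,7,9], [1,3,4,7],
   [1,3,5,8], [1,3,6,9], [1,4,8,9], [1,5,6,7], [2,3,4,8], [2,3,5,9], [2,3,6,7], [2,4,6,9],
   [2,5,7,8], [3,4,5,6], [3,7,8,9], [4,5,7,9], [4,6,7,8], [5,6,8,9]]"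

text \<open>The 4-blocks are the sets \<open>{2a, 2b, 2c + 1, 2d + 1}\<close>, where \<open>ab\<close> and \<open>cd\<close> are distinct edges of
  the same factor in a fixed one-factorization of the complete graph on \<open>{0..5}\<close>.\<close>

definition h6 :: "nat list list" where
  "h6 = [[0,2,4,6,8,10], [0,2,5,9], [0,2,7,11], [0,3,4,11], [0,3,5,6], [0,3,7,8], [0,3,9,10],
   [0,4,7,9], [0,5,7,10], [0,5,8,11], [0,6,9,11], [1,2,4,7], [1,2,5,10], [1,2,6,9], [1,2,8,11],
   [1,3,4,8], [1,3,5,7,9,11], [1,3,6,10], [1,4,6,11], [1,4,9,10], [1,5,6,8], [1,7,8,10],
   [2,4,9,11], [2,5,6,11], [2,5,7,8], [2,7,9,10], [3,4,6,9], [3,4,7,10], [3,5,8,10],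
   [3,6,8,11], [4,7,8,11], [5,6,9,10]]"

text \<open>Unique existence is phrased as a count so that it can be decided by evaluation.\<close>

definition listed :: "nat list list \<Rightarrow> nat \<Rightarrow> nat \<Rightarrow> nat \<Rightarrow> bool" where
  "listed bs a b c \<longleftrightarrow>
     length (filter (\<lambda>B. List.member B a \<and> List.member B b \<and> List.member B c) bs) = 1"

lemma sqs10_listed: "\<forall>c\<in>set [0..<10]. \<forall>b\<in>set [0..<c]. \<forall>a\<in>set [0..<b]. listed sqs10 a b c"
  by code_simp

text \<open>As \<open>a < b < c\<close> and halving is monotone, the two inequalities make all three
  indices distinct.\<close>

lemma h6_listed: "\<forall>c\<in>set [0..<12]. \<forall>b\<in>set [0..<c]. \<forall>a\<in>set [0..<b].
   a div 2 \<noteq> b div 2 \<longrightarrow> b div 2 \<noteq> c div 2 \<longrightarrow> listed h6 a b c"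
  by code_simp

lemma listed_ex1:
  assumes "listed bs a b c"
  shows "\<exists>!B. B \<in> set ` set bs \<and> {a, b, c} \<subseteq> B"
proof -
  have "\<exists>!B. B \<in> set bs \<and> List.member B a \<and> List.member B b \<and> List.member B c"
    using assms unfolding listed_def by (rule ex1_if_filter_singleton)
  then show ?thesis by auto
qed

lemma exact_cover_sqs10: "exact_cover (set ` set sqs10) (triples {..<10})"
proof (rule exact_coverI)
  fix T :: "nat set" assume T: "T \<in> triples {..<10}"
  then show 3: "card T = 3" by (simp add: triples_def)
  then obtain a b c where abc: "T = {a, b, c}" "a < b" "b < c" by (rule sorted_triple)
  then have "c < 10" using T by (simp add: triples_def)
  then have "listed sqs10 a b c" using sqs10_listed abc by simp
  then show "\<exists>!B. B \<in> set ` set sqs10 \<and> T \<subseteq> B" unfolding abc(1) by (rule listed_ex1)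
next
  have *: "\<forall>B\<in>set sqs10. length B = 4 \<and> distinct B \<and> (\<forall>x\<in>set B. x < 10)"
    by code_simp
  show "card B = 4 \<or> card B = 6" if "B \<in> set ` set sqs10" for B
    using * that by (auto simp: distinct_card)
  show "T \<in> triples {..<10}" if "B \<in> set ` set sqs10" "T \<subseteq> B" "card T = 3" for B T
    using * that by (fastforce simp: triples_def)
qed

lemma exact_cover_h6: "exact_cover (set ` set h6) (triples {..<12} \<inter> Collect transversal)"
proof (rule exact_coverI)
  fix T :: "nat set" assume T: "T \<in> triples {..<12} \<inter> Collect transversal"
  then show 3: "card T = 3" by (simp add: triples_def)
  then obtain a b c where abc: "T = {a, b, c}" "a < b" "b < c" by (rule sorted_triple)
  then have "c < 12" "a div 2 \<noteq> b div 2" "b div 2 \<noteq> c div 2"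
    using T by (auto simp: triples_def transversal_def inj_on_def)
  then have "listed h6 a b c" using h6_listed abc by simp
  then show "\<exists>!B. B \<in> set ` set h6 \<and> T \<subseteq> B" unfolding abc(1) by (rule listed_ex1)
next
  have *: "\<forall>B\<in>set h6. (length B = 4 \<or> length B = 6) \<and> distinct (map (\<lambda>x. x div 2) B) \<and>
      (\<forall>x\<in>set B. x < 12)"
    by code_simp
  show "card B = 4 \<or> card B = 6" if "B \<in> set ` set h6" for B
    using * that by (auto simp: distinct_card distinct_map)
  show "T \<in> triples {..<12} \<inter> Collect transversal"
    if "B \<in> set ` set h6" "T \<subseteq> B" "card T = 3" for B T
  proof -
    have "inj_on (\<lambda>x. x div 2) B" "B \<subseteq> {..<12}" using * that(1) by (auto simp: distinct_map)
    then show ?thesis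
      using that by (auto simp: triples_def transversal_def dest: inj_on_subset)
  qed
qed

lemma is_S3_46_block: "is_S3_46 X \<B> \<Longrightarrow> B \<in> \<B> \<Longrightarrow> B \<subseteq> X \<and> (card B = 4 \<or> card B = 6)"
  by (simp add: is_S3_46_def)

lemma exact_cover_single:
  assumes "card X = 4 \<or> card X = 6"
  shows "exact_cover {X} (triples X)"
  using assms by (auto simp: exact_cover_def triples_def)

lemma exact_cover_10:
  assumes "card X = 10"
  shows "\<exists>\<D>. exact_cover \<D> (triples X)"
proof -
  have "finite X" using assms card.infinite by fastforce
  then obtain f where "bij_betw f {..<10::nat} X"
    using assms ex_bij_betw_nat_finite[of X] by (auto simp: atLeast0LessThan)
  then have f: "inj_on f {..<10}" "f ` {..<10} = X" by (auto simp: bij_betw_def)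
  have "exact_cover ((`) f ` (set ` set sqs10)) (triples (f ` {..<10}) \<inter> Collect (\<lambda>_. True))"
  proof (rule exact_cover_image[where P = "\<lambda>_. True"])
    show "exact_cover (set ` set sqs10) (triples {..<10} \<inter> Collect (\<lambda>_. True))"
      using exact_cover_sqs10 by simp
    show "B \<subseteq> {..<10}" if "B \<in> set ` set sqs10" for B
      using exact_cover_sqs10 that is_S3_46_iff_exact_cover is_S3_46_block by metis
  qed (use f in auto)
  then show ?thesis using f by auto
qed

lemma exact_cover_transversal_6:
  assumes "card Y = 6"
  shows "\<exists>\<D>. exact_cover \<D> (triples (dbl Y) \<inter> Collect transversal)"
proof -
  have "finite Y" using assms card.infinite by fastforce
  then obtain h where "bij_betw h {..<6::nat} Y"
    using assms ex_bij_betw_nat_finite[of Y] by (auto simp: atLeast0LessThan)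
  then have h: "inj_on h {..<6}" "h ` {..<6} = Y" by (auto simp: bij_betw_def)
  \<comment> \<open>The labelling \<open>h\<close> of the indices is lifted to points; keeping the
    parity sends pairs to pairs.\<close>
  define f where "f x = 2 * h (x div 2) + x mod 2" for x
  have f_div: "f x div 2 = h (x div 2)" and f_mod: "f x mod 2 = x mod 2" for x
    by (auto simp: f_def)
  have h_eq: "h (x div 2) = h (y div 2) \<longleftrightarrow> x div 2 = y div 2" if "x < 12" "y < 12" for x y
    by (rule inj_on_eq_iff[OF h(1)]) (use that in auto)
  have inj: "inj_on f {..<12}"
  proof (rule inj_onI)
    fix x y assume "x \<in> {..<12::nat}" "y \<in> {..<12}" and e: "f x = f y"
    then have "x div 2 = y div 2" using h_eq f_div by (metis lessThan_iff)
    moreover have "x mod 2 = y mod 2" using e f_mod by metis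
    ultimately show "x = y" by (metis div_mult_mod_eq)
  qed
  have img: "f ` {..<12} = dbl Y"
  proof (rule card_subset_eq)
    show "finite (dbl Y)" using \<open>finite Y\<close> by (rule finite_dbl)
    show "f ` {..<12} \<subseteq> dbl Y" using h(2) by (auto simp: dbl_def f_div)
    show "card (f ` {..<12}) = card (dbl Y)" using inj assms by (simp add: card_image card_dbl)
  qed
  have "exact_cover ((`) f ` (set ` set h6)) (triples (f ` {..<12}) \<inter> Collect transversal)"
  proof (rule exact_cover_image[OF exact_cover_h6 inj])
    show "transversal (f ` T) \<longleftrightarrow> transversal T" if "T \<subseteq> {..<12}" for T
    proof -
      have "f x = f y \<longleftrightarrow> x = y" "f x div 2 = f y div 2 \<longleftrightarrow> x div 2 = y div 2"
        if "x \<in> T" "y \<in> T" for x y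
        using that \<open>T \<subseteq> {..<12}\<close> inj_on_eq_iff[OF inj, of x y] h_eq[of x y] f_div by auto
      then show ?thesis by (simp add: transversal_def inj_on_def)
    qed
    show "B \<subseteq> {..<12}" if "B \<in> set ` set h6" for B
    proof -
      have "\<forall>B\<in>set h6. \<forall>x\<in>set B. x < 12" by code_simp
      then show ?thesis using that by auto
    qed
  qed
  then show ?thesis using img by auto
qed

text \<open>The sum has the parity of the number of odd points. For four pairs these sets are
  therefore the even-weight binary words of length 4, in which any three letters determine the
  fourth.\<close>

definition even_transversals :: "nat set \<Rightarrow> nat set set" where
  "even_transversals Y = {U. U \<subseteq> dbl Y \<and> transversal U \<and> card U = 4 \<and> even (\<Sum>U)}"

lemma exact_cover_even_transversals:
  assumes Y: "card Y = 4"
  shows "exact_cover (even_transversals Y) (triples (dbl Y) \<inter> Collect transversal)"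
proof (rule exact_coverI)
  fix T assume T: "T \<in> triples (dbl Y) \<inter> Collect transversal"
  then show 3: "card T = 3" by (simp add: triples_def)
  have fY: "finite Y" using Y card.infinite by fastforce
  have fT: "finite T" using 3 card.infinite by fastforce
  let ?p = "\<lambda>x::nat. x div 2"
  have inj: "inj_on ?p T" and sub: "?p ` T \<subseteq> Y"
    using T by (auto simp: triples_def transversal_def dbl_def)
  have "card (?p ` T) = 3" using inj 3 by (simp add: card_image)
  then have "card (Y - ?p ` T) = 1" using Y sub fY by (simp add: card_Diff_subset finite_subset)
  then obtain b where b: "Y - ?p ` T = {b}" by (auto simp: card_1_singleton_iff)
  \<comment> \<open>The index \<open>b\<close> is the one missed by \<open>T\<close>, and the parity
    condition leaves only this point of its pair.\<close>
  define y where "y = 2 * b + \<Sum>T mod 2"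
  have y2: "y div 2 = b" by (simp add: y_def)
  have yT: "y \<notin> T" using b y2 by blast
  show "\<exists>!B. B \<in> even_transversals Y \<and> T \<subseteq> B"
  proof (rule ex1I[of _ "insert y T"])
    have "even (\<Sum>(insert y T))" using fT yT by (simp add: y_def)
    moreover have "transversal (insert y T)"
      using inj b y2 by (auto simp: transversal_def inj_on_insert)
    moreover have "insert y T \<subseteq> dbl Y" using sub b y2 by (auto simp: dbl_def)
    ultimately show "insert y T \<in> even_transversals Y \<and> T \<subseteq> insert y T"
      using fT yT 3 by (auto simp: even_transversals_def)
  next
    fix U assume U: "U \<in> even_transversals Y \<and> T \<subseteq> U"
    then have c: "card U = 4" and injU: "inj_on ?p U" and subU: "?p ` U \<subseteq> Y" and ev: "even (\<Sum>U)"
      by (auto simp: even_transversals_def transversal_def dbl_def)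
    have fU: "finite U" using c card.infinite by fastforce
    have "card (U - T) = 1" using c 3 U fT by (simp add: card_Diff_subset)
    then obtain z where z: "U - T = {z}" by (auto simp: card_1_singleton_iff)
    then have Uz: "U = insert z T" "z \<notin> T" using U by auto
    have "z div 2 \<notin> ?p ` T" using injU Uz by (auto simp: inj_on_insert)
    then have zb: "z div 2 = b" using b subU Uz by blast
    have "even (z + \<Sum>T)" using ev Uz fT by simp
    then have "z mod 2 = \<Sum>T mod 2" by presburger
    then have "z = y" using zb unfolding y_def by (metis mult_div_mod_eq)
    then show "U = insert y T" using Uz by simp
  qed
next
  fix B T assume "B \<in> even_transversals Y" "T \<subseteq> B" "card T = 3"
  then show "T \<in> triples (dbl Y) \<inter> Collect transversal"
    by (auto simp: even_transversals_def triples_def transversal_def dest: inj_on_subset)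
qed (simp add: even_transversals_def)

section \<open>Doubling\<close>

lemma card_div2_image_ge:
  assumes "card T = 3"
  shows "2 \<le> card ((\<lambda>x::nat. x div 2) ` T)" (is "2 \<le> card ?P")
proof (rule ccontr)
  assume "\<not> 2 \<le> card ?P"
  moreover have "finite T" using assms card.infinite by fastforce
  ultimately have "card (dbl ?P) \<le> 2" "finite (dbl ?P)" by (auto simp: card_dbl finite_dbl)
  moreover have "T \<subseteq> dbl ?P" by (auto simp: dbl_def)
  ultimately show False using assms card_mono[of "dbl ?P" T] by simp
qed

text \<open>The points over a set in \<F> receive a complete design, which also covers the triples
  meeting only two pairs; over a set in \<H> only transversal triples are covered. The sizes 2, 3, 5
  double to 4, 6, 10, where a single block or the system on 10 points serves.\<close>

lemma doubling:
  fixes \<F> \<H> :: "nat set set"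
  assumes F: "\<And>F. F \<in> \<F> \<Longrightarrow> F \<subseteq> {..<n} \<and> (card F = 2 \<or> card F = 3 \<or> card F = 5)"
    and H: "\<And>H. H \<in> \<H> \<Longrightarrow> H \<subseteq> {..<n} \<and> (card H = 4 \<or> card H = 6)"
    and pairs: "\<And>P. P \<subseteq> {..<n} \<Longrightarrow> card P = 2 \<Longrightarrow> \<exists>!F. F \<in> \<F> \<and> P \<subseteq> F"
    and triples: "\<And>P. P \<subseteq> {..<n} \<Longrightarrow> card P = 3 \<Longrightarrow> \<exists>!Y. Y \<in> \<F> \<union> \<H> \<and> P \<subseteq> Y"
  obtains \<B> where "is_S3_46 {..<2 * n} \<B>"
    and "\<And>F. F \<in> \<F> \<Longrightarrow> card F = 2 \<Longrightarrow> dbl F \<in> \<B>"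
    and "\<And>H. H \<in> \<H> \<Longrightarrow> card H = 4 \<Longrightarrow> even_transversals H \<subseteq> \<B>"
proof -
  let ?p = "\<lambda>x::nat. x div 2"
  define cell where "cell Y = (if Y \<in> \<F> then triples (dbl Y)
    else triples (dbl Y) \<inter> Collect transversal)" for Y
  have "\<exists>\<D>. exact_cover \<D> (cell Y) \<and> (Y \<in> \<F> \<longrightarrow> card Y = 2 \<longrightarrow> dbl Y \<in> \<D>) \<and>
      (Y \<in> \<H> \<longrightarrow> card Y = 4 \<longrightarrow> even_transversals Y \<subseteq> \<D>)" if Y: "Y \<in> \<F> \<union> \<H>" for Y
  proof (cases "Y \<in> \<F>")
    case True
    have 1: "exact_cover {dbl Y} (cell Y)" if "card Y = 2 \<or> card Y = 3"
      using exact_cover_single[of "dbl Y"] that True by (auto simp: cell_def card_dbl)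
    have 2: "\<exists>\<D>. exact_cover \<D> (cell Y)" if "card Y = 5"
      using exact_cover_10[of "dbl Y"] that True by (auto simp: cell_def card_dbl)
    have "card Y = 2 \<or> card Y = 3 \<or> card Y = 5" using F True by blast
    moreover have "Y \<notin> \<H>" using F[OF True] H[of Y] by auto
    ultimately show ?thesis using 1 2 by auto
  next
    case False
    then have "Y \<in> \<H>" "card Y = 4 \<or> card Y = 6" using Y H by auto
    then show ?thesis
      using False exact_cover_even_transversals[of Y] exact_cover_transversal_6[of Y]
      by (auto simp: cell_def)
  qed
  then obtain \<D> where D: "\<And>Y. Y \<in> \<F> \<union> \<H> \<Longrightarrow> exact_cover (\<D> Y) (cell Y)"
      "\<And>Y. Y \<in> \<F> \<Longrightarrow> card Y = 2 \<Longrightarrow> dbl Y \<in> \<D> Y"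
      "\<And>Y. Y \<in> \<H> \<Longrightarrow> card Y = 4 \<Longrightarrow> even_transversals Y \<subseteq> \<D> Y"
    by (metis (no_types, lifting) UnI1 UnI2)
  have cellD: "card T = 3" "?p ` T \<subseteq> Y" "Y \<in> \<F> \<or> card (?p ` T) = 3" if "T \<in> cell Y" for T Y
    using that by (auto simp: cell_def triples_def dbl_def transversal_def card_image split: if_splits)
  have "exact_cover (\<Union>Y\<in>\<F> \<union> \<H>. \<D> Y) (\<Union>Y\<in>\<F> \<union> \<H>. cell Y)"
  proof (rule exact_cover_UN)
    fix Y Z T assume YZ: "Y \<in> \<F> \<union> \<H>" "Z \<in> \<F> \<union> \<H>" "T \<in> cell Y" "T \<in> cell Z"
    have sub: "?p ` T \<subseteq> {..<n}" using YZ(1) cellD(2)[OF YZ(3)] F H by blast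
    have "card (?p ` T) \<le> 3" using cellD(1)[OF YZ(3)] card_image_le[of T ?p]
      by (metis card.infinite zero_neq_numeral)
    then consider "card (?p ` T) = 2" | "card (?p ` T) = 3"
      using card_div2_image_ge[OF cellD(1)[OF YZ(3)]] by linarith
    then show "Y = Z"
    proof cases
      case 1
      \<comment> \<open>A triple with only two indices is not transversal, so only a cell of \<F>
        can contain it.\<close>
      then have "Y \<in> \<F>" "Z \<in> \<F>" using cellD(3)[OF YZ(3)] cellD(3)[OF YZ(4)] by auto
      then show ?thesis using pairs[OF sub 1] cellD(2)[OF YZ(3)] cellD(2)[OF YZ(4)] by blast
    next
      case 2
      then show ?thesis using triples[OF sub 2] cellD(2)[OF YZ(3)] cellD(2)[OF YZ(4)] YZ by blast
    qed
  qed (rule D(1))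
  moreover have "(\<Union>Y\<in>\<F> \<union> \<H>. cell Y) = triples {..<2 * n}"
  proof (intro equalityI subsetI)
    fix T assume "T \<in> (\<Union>Y\<in>\<F> \<union> \<H>. cell Y)"
    then obtain Y where Y: "Y \<in> \<F> \<union> \<H>" "T \<in> cell Y" by blast
    then have "?p ` T \<subseteq> {..<n}" using cellD(2) F H by blast
    then show "T \<in> triples {..<2 * n}" using cellD(1)[OF Y(2)] by (auto simp: triples_def)
  next
    fix T assume "T \<in> triples {..<2 * n}"
    then have 3: "card T = 3" and sub: "?p ` T \<subseteq> {..<n}" by (auto simp: triples_def)
    have Td: "T \<subseteq> dbl Y" if "?p ` T \<subseteq> Y" for Y using that by (auto simp: dbl_def)
    have fT: "finite T" using 3 card.infinite by fastforce
    have "card (?p ` T) \<le> 3" using 3 fT card_image_le[of T ?p] by simp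
    then consider "card (?p ` T) = 2" | "card (?p ` T) = 3"
      using card_div2_image_ge[OF 3] by linarith
    then show "T \<in> (\<Union>Y\<in>\<F> \<union> \<H>. cell Y)"
    proof cases
      case 1
      then obtain F where "F \<in> \<F>" "?p ` T \<subseteq> F" using pairs[OF sub] by blast
      then have "T \<in> cell F" using Td 3 by (simp add: cell_def triples_def)
      then show ?thesis using \<open>F \<in> \<F>\<close> by blast
    next
      case 2
      then have "transversal T" using 3 fT by (simp add: transversal_def eq_card_imp_inj_on)
      obtain Y where "Y \<in> \<F> \<union> \<H>" "?p ` T \<subseteq> Y" using triples[OF sub 2] by blast
      then have "T \<in> cell Y" using Td 3 \<open>transversal T\<close> by (simp add: cell_def triples_def)
      then show ?thesis using \<open>Y \<in> \<F> \<union> \<H>\<close> by blast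
    qed
  qed
  ultimately have "is_S3_46 {..<2 * n} (\<Union>Y\<in>\<F> \<union> \<H>. \<D> Y)"
    by (simp add: is_S3_46_iff_exact_cover)
  then show thesis by (rule that) (use D in blast)+
qed

text \<open>Here \<F> consists of all pairs of base points, which are too small to contain a
  triple.\<close>

lemma doubling_same:
  assumes D: "is_S3_46 {..<n} \<A>"
  obtains \<B> where "is_S3_46 {..<2 * n} \<B>"
    and "\<And>F. F \<subseteq> {..<n} \<Longrightarrow> card F = 2 \<Longrightarrow> dbl F \<in> \<B>"
    and "\<And>H. H \<in> \<A> \<Longrightarrow> card H = 4 \<Longrightarrow> even_transversals H \<subseteq> \<B>"
proof -
  define \<F> where "\<F> = {F. F \<subseteq> {..<n} \<and> card F = 2}"
  have F: "F \<subseteq> {..<n}" "card F = 2" "finite F" if "F \<in> \<F>" for F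
    using that by (auto simp: \<F>_def intro: finite_subset)
  obtain \<B> where "is_S3_46 {..<2 * n} \<B>" "\<And>F. F \<in> \<F> \<Longrightarrow> card F = 2 \<Longrightarrow> dbl F \<in> \<B>"
    "\<And>H. H \<in> \<A> \<Longrightarrow> card H = 4 \<Longrightarrow> even_transversals H \<subseteq> \<B>"
  proof (rule doubling[of \<F> n \<A>])
    fix P assume P: "P \<subseteq> {..<n}" "card P = 2"
    show "\<exists>!F. F \<in> \<F> \<and> P \<subseteq> F"
    proof (rule ex1I[of _ P])
      show "F = P" if "F \<in> \<F> \<and> P \<subseteq> F" for F
        using card_subset_eq[of F P] F[of F] P(2) that by simp
    qed (use P in \<open>simp add: \<F>_def\<close>)
  next
    fix P assume P: "P \<subseteq> {..<n}" "card P = 3"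
    have "\<exists>!B. B \<in> \<A> \<and> P \<subseteq> B" using D P by (simp add: is_S3_46_def)
    moreover have "\<not> P \<subseteq> F" if "F \<in> \<F>" for F
      using card_mono[of F P] F[OF that] P by auto
    ultimately show "\<exists>!Y. Y \<in> \<F> \<union> \<A> \<and> P \<subseteq> Y" by blast
  qed (use F is_S3_46_block[OF D] in auto)
  then show thesis by (intro that) (auto simp: \<F>_def)
qed

text \<open>The blocks through \<open>n\<close>, with \<open>n\<close> removed, form \<F>. A pair
  \<open>P\<close> lies in exactly one of them because \<open>insert n P\<close> lies in exactly one
  block. The lemma serves odd \<open>n\<close>, where the base design has the even number
  \<open>Suc n\<close> of points.\<close>

lemma doubling_delete:
  assumes D: "is_S3_46 {..<Suc n} \<A>"
  obtains \<B> where "is_S3_46 {..<2 * n} \<B>"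
    and "\<And>H. H \<in> \<A> \<Longrightarrow> n \<notin> H \<Longrightarrow> card H = 4 \<Longrightarrow> even_transversals H \<subseteq> \<B>"
proof -
  define \<F> where "\<F> = {A - {n} | A. A \<in> \<A> \<and> n \<in> A}"
  define \<H> where "\<H> = {A \<in> \<A>. n \<notin> A}"
  have A: "A \<subseteq> {..<Suc n}" "card A = 4 \<or> card A = 6" if "A \<in> \<A>" for A
    using is_S3_46_block[OF D that] by auto
  have ex: "\<exists>!B. B \<in> \<A> \<and> T \<subseteq> B" if "T \<subseteq> {..<Suc n}" "card T = 3" for T
    using D that by (simp add: is_S3_46_def)
  have less: "X \<subseteq> {..<n}" if "X \<subseteq> {..<Suc n}" "n \<notin> X" for X
    using that by (auto simp: less_Suc_eq)
  obtain \<B> where "is_S3_46 {..<2 * n} \<B>" "\<And>F. F \<in> \<F> \<Longrightarrow> card F = 2 \<Longrightarrow> dbl F \<in> \<B>"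
    "\<And>H. H \<in> \<H> \<Longrightarrow> card H = 4 \<Longrightarrow> even_transversals H \<subseteq> \<B>"
  proof (rule doubling[of \<F> n \<H>])
    fix F assume "F \<in> \<F>"
    then obtain A where "A \<in> \<A>" "n \<in> A" "F = A - {n}" by (auto simp: \<F>_def)
    then show "F \<subseteq> {..<n} \<and> (card F = 2 \<or> card F = 3 \<or> card F = 5)"
      using A[of A] less[of F] by auto
  next
    fix H assume "H \<in> \<H>"
    then show "H \<subseteq> {..<n} \<and> (card H = 4 \<or> card H = 6)" using A less by (simp add: \<H>_def)
  next
    fix P assume P: "P \<subseteq> {..<n}" "card P = 2"
    then have "n \<notin> P" "finite P" by (auto intro: finite_subset)
    then have iP: "insert n P \<subseteq> {..<Suc n}" "card (insert n P) = 3" using P by auto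
    from ex[OF iP] obtain A where A: "A \<in> \<A> \<and> insert n P \<subseteq> A"
      and u: "\<forall>A'. A' \<in> \<A> \<and> insert n P \<subseteq> A' \<longrightarrow> A' = A"
      by (rule ex1E)
    show "\<exists>!F. F \<in> \<F> \<and> P \<subseteq> F"
    proof (rule ex1I[of _ "A - {n}"])
      show "A - {n} \<in> \<F> \<and> P \<subseteq> A - {n}" using A \<open>n \<notin> P\<close> by (auto simp: \<F>_def)
      show "F = A - {n}" if "F \<in> \<F> \<and> P \<subseteq> F" for F using that u unfolding \<F>_def by blast
    qed
  next
    fix P assume P: "P \<subseteq> {..<n}" "card P = 3"
    then have P': "P \<subseteq> {..<Suc n}" by auto
    from ex[OF P' P(2)] obtain A where A: "A \<in> \<A> \<and> P \<subseteq> A"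
      and u: "\<forall>A'. A' \<in> \<A> \<and> P \<subseteq> A' \<longrightarrow> A' = A"
      by (rule ex1E)
    have nP: "n \<notin> P" using P by auto
    show "\<exists>!Y. Y \<in> \<F> \<union> \<H> \<and> P \<subseteq> Y"
    \<comment> \<open>If \<open>n\<close> is not in \<open>A\<close>, then \<open>A - {n}\<close> is
      \<open>A\<close> itself, so one witness serves both families.\<close>
    proof (rule ex1I[of _ "A - {n}"])
      show "A - {n} \<in> \<F> \<union> \<H> \<and> P \<subseteq> A - {n}"
        using A nP by (cases "n \<in> A") (auto simp: \<F>_def \<H>_def)
      show "Y = A - {n}" if "Y \<in> \<F> \<union> \<H> \<and> P \<subseteq> Y" for Y
        using that u unfolding \<F>_def \<H>_def by blast
    qed
  qed blast
  then show thesis by (intro that) (auto simp: \<H>_def)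
qed

section \<open>Latin cubes\<close>

lemma xor_less_pow2:
  fixes a b :: nat
  assumes "a < 2 ^ k" "b < 2 ^ k"
  shows "a XOR b < 2 ^ k"
  using assms by (metis take_bit_nat_eq_self_iff take_bit_xor)

lemma xor_cancel [simp]:
  fixes a b :: nat
  shows "a XOR (a XOR b) = b" "(a XOR b) XOR b = a"
  by (metis xor.assoc xor_self_eq xor.left_neutral xor.right_neutral)+

lemma xor_left_cancel: "a XOR b = a XOR c \<longleftrightarrow> b = c" for a b c :: nat
  by (metis xor_cancel(1))

definition latin_cube :: "nat \<Rightarrow> (nat \<times> nat \<times> nat \<Rightarrow> nat) \<Rightarrow> bool" where
  "latin_cube q f \<longleftrightarrow>
     (\<forall>a<q. \<forall>b<q. \<forall>c<q. f (a, b, c) < q) \<and>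
     (\<forall>b<q. \<forall>c<q. inj_on (\<lambda>a. f (a, b, c)) {..<q}) \<and>
     (\<forall>a<q. \<forall>c<q. inj_on (\<lambda>b. f (a, b, c)) {..<q}) \<and>
     (\<forall>a<q. \<forall>b<q. inj_on (\<lambda>c. f (a, b, c)) {..<q})"

text \<open>The shift \<open>s\<close> is constant along the moves it prescribes, so \<open>a \<mapsto> a XOR s (a, b, c)\<close> is an
  involution, and likewise in the other coordinates.\<close>

lemma latin_cube_xor_shift:
  assumes q: "q = 2 ^ k"
    and less: "\<And>a b c. a < q \<Longrightarrow> b < q \<Longrightarrow> c < q \<Longrightarrow> s (a, b, c) < q"
    and s1: "\<And>a b c. s (a XOR s (a, b, c), b, c) = s (a, b, c)"
    and s2: "\<And>a b c. s (a, b XOR s (a, b, c), c) = s (a, b, c)"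
    and s3: "\<And>a b c. s (a, b, c XOR s (a, b, c)) = s (a, b, c)"
  shows "latin_cube q (\<lambda>(a, b, c). a XOR b XOR c XOR s (a, b, c))"
proof -
  \<comment> \<open>At the common value \<open>z = x XOR t x\<close> the function \<open>t\<close>
    equals both \<open>t x\<close> and \<open>t y\<close>, so these agree and cancel.\<close>
  have inj: "x = y" if "x XOR t x = y XOR t y" "\<And>z. t (z XOR t z) = t z"
    for x y :: nat and t :: "nat \<Rightarrow> nat"
    using that by (metis xor_cancel(2))
  have 1: "a = a'" if "a XOR b XOR c XOR s (a, b, c) = a' XOR b XOR c XOR s (a', b, c)" for a a' b c
  proof (rule inj[where t = "\<lambda>a. s (a, b, c)"])
    have "(b XOR c) XOR (a XOR s (a, b, c)) = (b XOR c) XOR (a' XOR s (a', b, c))"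
      using that by (simp add: ac_simps)
    then show "a XOR s (a, b, c) = a' XOR s (a', b, c)" by (simp only: xor_left_cancel)
  qed (rule s1)
  have 2: "b = b'" if "a XOR b XOR c XOR s (a, b, c) = a XOR b' XOR c XOR s (a, b', c)" for a b b' c
  proof (rule inj[where t = "\<lambda>b. s (a, b, c)"])
    have "(a XOR c) XOR (b XOR s (a, b, c)) = (a XOR c) XOR (b' XOR s (a, b', c))"
      using that by (simp add: ac_simps)
    then show "b XOR s (a, b, c) = b' XOR s (a, b', c)" by (simp only: xor_left_cancel)
  qed (rule s2)
  have 3: "c = c'" if "a XOR b XOR c XOR s (a, b, c) = a XOR b XOR c' XOR s (a, b, c')" for a b c c'
  proof (rule inj[where t = "\<lambda>c. s (a, b, c)"])
    show "c XOR s (a, b, c) = c' XOR s (a, b, c')" using that by (simp add: xor_left_cancel)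
  qed (rule s3)
  have "a XOR b XOR c XOR s (a, b, c) < q" if "a < q" "b < q" "c < q" for a b c
    using less that xor_less_pow2 unfolding q by auto
  then show ?thesis
    unfolding latin_cube_def by (intro conjI allI impI inj_onI) (simp_all, (blast intro: 1 2 3)+)
qed

text \<open>Greedy choice: the points of \<open>S\<close> receive their values one after the other.\<close>

lemma card_compatible_functions:
  fixes R :: "'a \<Rightarrow> 'b \<Rightarrow> 'a \<Rightarrow> 'b \<Rightarrow> bool"
  assumes "finite S" "finite C"
    and choice: "\<And>p D g. p \<in> S \<Longrightarrow> D \<subseteq> S \<Longrightarrow> p \<notin> D \<Longrightarrow> g \<in> D \<rightarrow>\<^sub>E C \<Longrightarrow>
      M \<le> card {v \<in> C. \<forall>p'\<in>D. R p v p' (g p')}"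
    and sym: "\<And>p v p' v'. R p v p' v' \<Longrightarrow> R p' v' p v"
  shows "M ^ card S \<le> card {g \<in> S \<rightarrow>\<^sub>E C. \<forall>p\<in>S. \<forall>p'\<in>S. p \<noteq> p' \<longrightarrow> R p (g p) p' (g p')}"
proof -
  define G where "G D = {g \<in> D \<rightarrow>\<^sub>E C. \<forall>p\<in>D. \<forall>p'\<in>D. p \<noteq> p' \<longrightarrow> R p (g p) p' (g p')}" for D
  have "D \<subseteq> S \<Longrightarrow> M ^ card D \<le> card (G D)" if "finite D" for D
    using that
  proof (induction D)
    case empty
    have "G {} = {\<lambda>_. undefined}" by (auto simp: G_def)
    then show ?case by simp
  next
    case (insert p D)
    have fin: "finite (G X)" if "X \<subseteq> S" for X
      unfolding G_def using assms(1,2) that by (simp add: finite_PiE finite_subset)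
    define V where "V g = {v \<in> C. \<forall>p'\<in>D. R p v p' (g p')}" for g
    have "M ^ card (insert p D) = M ^ card D * M" using insert by simp
    also have "\<dots> \<le> card (G D) * M" using insert by simp
    also have "\<dots> = (\<Sum>g\<in>G D. M)" by simp
    also have "\<dots> \<le> (\<Sum>g\<in>G D. card (V g))"
      by (rule sum_mono) (use insert choice in \<open>auto simp: V_def G_def\<close>)
    also have "\<dots> = card (SIGMA g:G D. V g)"
      using fin insert assms(2) by (simp add: V_def)
    also have "\<dots> \<le> card (G (insert p D))"
    proof (rule card_inj_on_le)
      \<comment> \<open>Functions in \<open>G D\<close> are \<open>undefined\<close> at
        \<open>p\<close>, so both \<open>g\<close> and \<open>v\<close> can be read off the
        extension.\<close>
      show "inj_on (\<lambda>(g, v). g(p := v)) (SIGMA g:G D. V g)"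
      proof (rule inj_onI, clarify)
        fix g v g' v' assume g: "g \<in> G D" "g' \<in> G D" and e: "g(p := v) = g'(p := v')"
        then have "g p = undefined" "g' p = undefined"
          using insert.hyps(2) PiE_arb[of _ D "\<lambda>_. C" p] by (auto simp: G_def)
        then have "g = g'" using e by (metis fun_upd_triv fun_upd_upd)
        then show "g = g' \<and> v = v'" using fun_cong[OF e, of p] by simp
      qed
      show "(\<lambda>(g, v). g(p := v)) ` (SIGMA g:G D. V g) \<subseteq> G (insert p D)"
      proof clarify
        fix g v assume g: "g \<in> G D" and v: "v \<in> V g"
        have "g(p := v) \<in> insert p D \<rightarrow>\<^sub>E C"
          using g v by (auto simp: G_def V_def PiE_def Pi_def extensional_def)
        moreover have "R p v p' (g p')" if "p' \<in> D" for p' using v that by (simp add: V_def)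
        ultimately show "g(p := v) \<in> G (insert p D)"
          using g sym insert.hyps by (auto simp: G_def)
      qed
      show "finite (G (insert p D))" using fin insert by blast
    qed
    finally show ?case .
  qed
  from this[OF assms(1) order_refl] show ?thesis unfolding G_def .
qed

section \<open>Subcubes of order 2 and their disjointness\<close>

fun move :: "nat \<times> nat \<times> nat \<Rightarrow> bool \<times> bool \<times> bool \<Rightarrow> nat \<Rightarrow> nat \<times> nat \<times> nat" where
  "move (a, b, c) (e1, e2, e3) v =
     (a XOR (if e1 then v else 0), b XOR (if e2 then v else 0), c XOR (if e3 then v else 0))"

abbreviation box :: "nat \<Rightarrow> (nat \<times> nat \<times> nat) set" where
  "box q \<equiv> {..<q} \<times> {..<q} \<times> {..<q}"

text \<open>The points \<open>move p e v\<close> for the eight \<open>e\<close> are the corners of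
  the subcube at \<open>p\<close> in direction \<open>v\<close>, so this is disjointness of two
  subcubes.\<close>

definition compatible :: "nat \<times> nat \<times> nat \<Rightarrow> nat \<Rightarrow> nat \<times> nat \<times> nat \<Rightarrow> nat \<Rightarrow> bool" where
  "compatible p v p' v' \<longleftrightarrow> (\<forall>e e'. move p e v \<noteq> move p' e' v')"

lemma compatible_sym: "compatible p v p' v' \<Longrightarrow> compatible p' v' p v"
  unfolding compatible_def by metis

lemma xor_ge_pow2:
  fixes x v :: nat
  assumes "x < 2 ^ k" "2 ^ k \<le> v"
  shows "2 ^ k \<le> x XOR v"
proof (rule ccontr)
  assume "\<not> 2 ^ k \<le> x XOR v"
  then have "x XOR (x XOR v) < 2 ^ k" using assms(1) xor_less_pow2[of x k "x XOR v"] by simp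
  then show False using assms(2) by simp
qed

text \<open>Directions are at least \<open>2 ^ k\<close> and base coordinates are smaller, so the
  size of the common value reveals whether a direction was added.\<close>

lemma xor_shift_eq:
  fixes x y v v' :: nat
  assumes xy: "x < 2 ^ k" "y < 2 ^ k" and v: "2 ^ k \<le> v" "2 ^ k \<le> v'"
    and eq: "x XOR (if e then v else 0) = y XOR (if e' then v' else 0)"
  shows "e' = e \<and> y = x XOR (if e then v XOR v' else 0)"
proof -
  have "e' = e"
    using eq xor_ge_pow2[OF xy(1) v(1)] xor_ge_pow2[OF xy(2) v(2)] xy by (auto split: if_splits)
  moreover have "y = x XOR (v XOR v')" if "x XOR v = y XOR v'"
    using that by (metis xor.assoc xor_cancel(2))
  ultimately show ?thesis using eq by auto
qed

text \<open>If two subcubes meet, the same coordinates were moved on both sides, so \<open>p\<close>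
  and \<open>p'\<close> differ by \<open>w = v XOR v'\<close> in exactly these coordinates. At least
  one is moved because \<open>p\<close> and \<open>p'\<close> are distinct, and there
  \<open>w\<close> is the XOR of two numbers below \<open>r\<close>.\<close>

lemma incompatible_imp:
  assumes r: "r = 2 ^ k" "r \<le> m" "m = 2 ^ l"
    and p: "p \<in> box r" "p' \<in> box r" "p \<noteq> p'" and v: "m \<le> v" "m \<le> v'"
    and n: "\<not> compatible p v p' v'"
  shows "\<exists>e. \<exists>w<r. p' = move p e w \<and> v = v' XOR w"
proof -
  obtain a b c a' b' c' where abc: "p = (a, b, c)" "p' = (a', b', c')"
    by (metis prod_cases3)
  have less: "a < m" "b < m" "c < m" "a' < m" "b' < m" "c' < m" using p r(2) abc by auto
  obtain e1 e2 e3 e1' e2' e3' where e: "move p (e1, e2, e3) v = move p' (e1', e2', e3') v'"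
    using n unfolding compatible_def by (metis prod_cases3)
  define w where "w = v XOR v'"
  have 1: "a' = a XOR (if e1 then w else 0)" and 2: "b' = b XOR (if e2 then w else 0)"
    and 3: "c' = c XOR (if e3 then w else 0)"
    using e v less xor_shift_eq[of a l a' v v' e1 e1'] xor_shift_eq[of b l b' v v' e2 e2']
      xor_shift_eq[of c l c' v v' e3 e3'] by (auto simp: abc r(3) w_def)
  have "e1 \<or> e2 \<or> e3" by (rule ccontr) (use 1 2 3 p(3) abc in simp)
  then have "w = a XOR a' \<or> w = b XOR b' \<or> w = c XOR c'" using 1 2 3 by auto
  moreover have "a < r" "b < r" "c < r" "a' < r" "b' < r" "c' < r" using p abc by auto
  ultimately have "w < r" using xor_less_pow2 unfolding r(1) by metis
  moreover have "p' = move p (e1, e2, e3) w" using 1 2 3 abc by simp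
  moreover have "v = v' XOR w" unfolding w_def by (metis xor.commute xor_cancel(1))
  ultimately show ?thesis by blast
qed

lemma latin_cube_cong:
  assumes "\<And>x. x \<in> box q \<Longrightarrow> f x = g x" "latin_cube q f"
  shows "latin_cube q g"
proof -
  have "f (a, b, c) = g (a, b, c)" if "a < q" "b < q" "c < q" for a b c
    using assms(1) that by simp
  note eq = this
  have "inj_on (\<lambda>a. g (a, b, c)) {..<q}" if "b < q" "c < q" for b c
  proof -
    have "inj_on (\<lambda>a. f (a, b, c)) {..<q}" using assms(2) that by (simp add: latin_cube_def)
    then show ?thesis by (rule inj_on_cong[THEN iffD1, rotated]) (simp add: eq that)
  qed
  moreover have "inj_on (\<lambda>b. g (a, b, c)) {..<q}" if "a < q" "c < q" for a c
  proof -
    have "inj_on (\<lambda>b. f (a, b, c)) {..<q}" using assms(2) that by (simp add: latin_cube_def)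
    then show ?thesis by (rule inj_on_cong[THEN iffD1, rotated]) (simp add: eq that)
  qed
  moreover have "inj_on (\<lambda>c. g (a, b, c)) {..<q}" if "a < q" "b < q" for a b
  proof -
    have "inj_on (\<lambda>c. f (a, b, c)) {..<q}" using assms(2) that by (simp add: latin_cube_def)
    then show ?thesis by (rule inj_on_cong[THEN iffD1, rotated]) (simp add: eq that)
  qed
  moreover have "g (a, b, c) < q" if "a < q" "b < q" "c < q" for a b c
    using assms(2) that by (simp add: latin_cube_def flip: eq)
  ultimately show ?thesis unfolding latin_cube_def by simp
qed

section \<open>Shifting the entries on disjoint subcubes\<close>

lemma move_flip:
  assumes "move p e v = (a, b, c)"
  shows "\<exists>e'. move p e' v = (a XOR v, b, c)"
    and "\<exists>e'. move p e' v = (a, b XOR v, c)"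
    and "\<exists>e'. move p e' v = (a, b, c XOR v)"
proof -
  obtain a0 b0 c0 e1 e2 e3 where pe: "p = (a0, b0, c0)" "e = (e1, e2, e3)" by (metis prod_cases3)
  then have abc: "a = a0 XOR (if e1 then v else 0)" "b = b0 XOR (if e2 then v else 0)"
    "c = c0 XOR (if e3 then v else 0)"
    using assms by auto
  have flip: "x XOR (if \<not> d then v else 0) = (x XOR (if d then v else 0)) XOR v" for x d by simp
  show "\<exists>e'. move p e' v = (a XOR v, b, c)"
    by (rule exI[of _ "(\<not> e1, e2, e3)"]) (simp only: pe move.simps flip abc)
  show "\<exists>e'. move p e' v = (a, b XOR v, c)"
    by (rule exI[of _ "(e1, \<not> e2, e3)"]) (simp only: pe move.simps flip abc)
  show "\<exists>e'. move p e' v = (a, b, c XOR v)"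
    by (rule exI[of _ "(e1, e2, \<not> e3)"]) (simp only: pe move.simps flip abc)
qed

text \<open>The default 0 leaves the XOR cube unchanged off the subcubes. For pairwise compatible
  choices a point lies in at most one subcube, so the description is unambiguous.\<close>

definition shift :: "(nat \<times> nat \<times> nat) set \<Rightarrow> (nat \<times> nat \<times> nat \<Rightarrow> nat) \<Rightarrow> nat \<times> nat \<times> nat \<Rightarrow> nat" where
  "shift S g x = (if \<exists>p\<in>S. \<exists>e. x = move p e (g p)
     then g (THE p. p \<in> S \<and> (\<exists>e. x = move p e (g p))) else 0)"

lemma shift_move:
  assumes g: "\<forall>p\<in>S. \<forall>p'\<in>S. p \<noteq> p' \<longrightarrow> compatible p (g p) p' (g p')" and "p \<in> S"
  shows "shift S g (move p e (g p)) = g p"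
proof -
  have "(THE p'. p' \<in> S \<and> (\<exists>e'. move p e (g p) = move p' e' (g p'))) = p"
  proof (rule the_equality)
    show "p \<in> S \<and> (\<exists>e'. move p e (g p) = move p e' (g p))" using assms(2) by blast
    show "p' = p" if "p' \<in> S \<and> (\<exists>e'. move p e (g p) = move p' e' (g p'))" for p'
      using that assms unfolding compatible_def by metis
  qed
  moreover have "\<exists>p'\<in>S. \<exists>e'. move p e (g p) = move p' e' (g p')" using assms(2) by blast
  ultimately show ?thesis unfolding shift_def by presburger
qed

text \<open>Moving a corner by its own direction leads to another corner of the same subcube, where
  the shift has the same value.\<close>

lemma latin_cube_shift:
  assumes q: "q = 2 ^ k"
    and g: "\<forall>p\<in>S. \<forall>p'\<in>S. p \<noteq> p' \<longrightarrow> compatible p (g p) p' (g p')"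
    and less: "\<And>p. p \<in> S \<Longrightarrow> g p < q"
  shows "latin_cube q (\<lambda>(a, b, c). a XOR b XOR c XOR shift S g (a, b, c))"
proof (rule latin_cube_xor_shift[OF q])
  have cases: "shift S g x = 0 \<or> (\<exists>p\<in>S. \<exists>e. x = move p e (g p) \<and> shift S g x = g p)" for x
  proof (cases "\<exists>p\<in>S. \<exists>e. x = move p e (g p)")
    case True
    then show ?thesis using shift_move[OF g] by blast
  next
    case False
    then show ?thesis unfolding shift_def by presburger
  qed
  show "shift S g (a, b, c) < q" for a b c
    using cases[of "(a, b, c)"] less q by auto
  have step: "shift S g (a', b', c') = shift S g (a, b, c)"
    if "\<And>p e. move p e (shift S g (a, b, c)) = (a, b, c) \<Longrightarrow>
          \<exists>e'. move p e' (shift S g (a, b, c)) = (a', b', c')"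
      and "shift S g (a, b, c) = 0 \<Longrightarrow> (a', b', c') = (a, b, c)" for a b c a' b' c'
    using cases[of "(a, b, c)"] that shift_move[OF g] by metis
  show "shift S g (a XOR shift S g (a, b, c), b, c) = shift S g (a, b, c)" for a b c
    by (rule step, erule move_flip(1), simp)
  show "shift S g (a, b XOR shift S g (a, b, c), c) = shift S g (a, b, c)" for a b c
    by (rule step, erule move_flip(2), simp)
  show "shift S g (a, b, c XOR shift S g (a, b, c)) = shift S g (a, b, c)" for a b c
    by (rule step, erule move_flip(3), simp)
qed

section \<open>Counting Latin cubes\<close>

definition latin_cubes :: "nat \<Rightarrow> (nat \<times> nat \<times> nat \<Rightarrow> nat) set" where
  "latin_cubes q = {f \<in> box q \<rightarrow>\<^sub>E {..<q}. latin_cube q f}"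

lemma card_latin_cubes_ge:
  assumes r: "r = 2 ^ k"
  shows "r ^ (r ^ 3) \<le> card (latin_cubes (32 * r))"
proof -
  \<comment> \<open>There are \<open>m\<close> directions, and at most \<open>8 * r\<close> of them
    are blocked at each greedy choice; \<open>m = 8 * r\<close> would leave none guaranteed. As a
    power of two not below \<open>r\<close>, \<open>m\<close> separates directions from base
    coordinates.\<close>
  define m where "m = 16 * r"
  have m: "m = 2 ^ (k + 4)" "r \<le> m" by (simp_all add: m_def r power_add)
  define C where "C = {m..<2 * m}"
  define G where "G = {g \<in> box r \<rightarrow>\<^sub>E C. \<forall>p\<in>box r. \<forall>p'\<in>box r. p \<noteq> p' \<longrightarrow> compatible p (g p) p' (g p')}"
  have choice: "r \<le> card {v \<in> C. \<forall>p'\<in>D. compatible p v p' (g p')}"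
    if p: "p \<in> box r" and D: "D \<subseteq> box r" "p \<notin> D" and g: "g \<in> D \<rightarrow>\<^sub>E C" for p D g
  proof -
    \<comment> \<open>The pair \<open>(e, w)\<close> determines the earlier point
      \<open>move p e w\<close> and thus the blocked direction, so the bound does not grow with the
      number of points already treated.\<close>
    define bad where "bad = (\<lambda>(e, w). g (move p e w) XOR w) ` (UNIV \<times> {..<r})"
    have "card bad \<le> card ((UNIV :: (bool \<times> bool \<times> bool) set) \<times> {..<r})"
      unfolding bad_def by (rule card_image_le) simp
    also have "\<dots> = 8 * r" by (simp add: card_cartesian_product flip: UNIV_Times_UNIV)
    finally have card_bad: "card bad \<le> 8 * r" .
    have fin: "finite bad" unfolding bad_def by simp
    have "C - bad \<subseteq> {v \<in> C. \<forall>p'\<in>D. compatible p v p' (g p')}"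
    proof (intro subsetI CollectI conjI ballI)
      fix v p' assume v: "v \<in> C - bad" and p': "p' \<in> D"
      have "g p' \<in> C" using g p' by auto
      then have ge: "m \<le> v" "m \<le> g p'" using v by (auto simp: C_def)
      show "compatible p v p' (g p')"
      proof (rule ccontr)
        assume n: "\<not> compatible p v p' (g p')"
        have "p' \<in> box r" "p \<noteq> p'" using D p' by auto
        from incompatible_imp[OF r m(2,1) p this ge n]
        obtain e w where "w < r" "p' = move p e w" "v = g p' XOR w" by blast
        then have "v \<in> bad" unfolding bad_def by (intro image_eqI[of _ _ "(e, w)"]) auto
        then show False using v by simp
      qed
    qed simp
    then have "card (C - bad) \<le> card {v \<in> C. \<forall>p'\<in>D. compatible p v p' (g p')}"
      by (intro card_mono) (auto simp: C_def)
    moreover have "card C - card bad \<le> card (C - bad)" using fin by (rule diff_card_le_card_Diff)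
    moreover have "card C = 16 * r" by (simp add: C_def m_def)
    ultimately show ?thesis using card_bad by linarith
  qed
  have "r ^ card (box r) \<le> card G"
    unfolding G_def
    by (rule card_compatible_functions[OF _ _ choice compatible_sym]) (auto simp: C_def)
  moreover have "card (box r) = r ^ 3" by (simp add: card_cartesian_product power3_eq_cube)
  moreover have "card G \<le> card (latin_cubes (2 * m))"
  proof (rule card_inj_on_le)
    define F where "F g = restrict (\<lambda>(a, b, c). a XOR b XOR c XOR shift (box r) g (a, b, c)) (box (2 * m))" for g
    have q: "2 * m = 2 ^ (k + 5)" by (simp add: m(1) power_add)
    show "F ` G \<subseteq> latin_cubes (2 * m)"
    proof (rule image_subsetI)
      fix g assume g: "g \<in> G"
      have "latin_cube (2 * m) (\<lambda>(a, b, c). a XOR b XOR c XOR shift (box r) g (a, b, c))"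
        by (rule latin_cube_shift[OF q]) (use g in \<open>auto simp: G_def C_def\<close>)
      then have "latin_cube (2 * m) (F g)"
        by (rule latin_cube_cong[rotated]) (simp add: F_def)
      moreover have "F g \<in> box (2 * m) \<rightarrow>\<^sub>E {..<2 * m}"
      proof (rule PiE_I)
        show "F g x \<in> {..<2 * m}" if "x \<in> box (2 * m)" for x
          using \<open>latin_cube (2 * m) (F g)\<close> that by (auto simp: latin_cube_def)
      qed (simp add: F_def)
      ultimately show "F g \<in> latin_cubes (2 * m)" by (simp add: latin_cubes_def)
    qed
    show "inj_on F G"
    proof (rule inj_onI)
      fix g g' assume g: "g \<in> G" and g': "g' \<in> G" and eq: "F g = F g'"
      have "g p = g' p" if p: "p \<in> box r" for p
      proof -
        obtain a b c where abc: "p = (a, b, c)" by (metis prod_cases3)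
        have "p \<in> box (2 * m)" using p m(2) by auto
        then have "a XOR b XOR c XOR shift (box r) g p = a XOR b XOR c XOR shift (box r) g' p"
          using fun_cong[OF eq, of p] by (simp add: F_def abc)
        then have "shift (box r) g p = shift (box r) g' p" by (simp only: xor_left_cancel)
        \<comment> \<open>By the trivial move, \<open>p\<close> is a corner of its own subcube, so
          the entries on \<open>box r\<close> reveal the choice of directions.\<close>
        moreover have "shift (box r) h p = h p" if "h \<in> G" for h
          using shift_move[of "box r" h p "(False, False, False)"] that p by (simp add: G_def abc)
        ultimately show ?thesis using g g' by simp
      qed
      then show "g = g'" using g g' unfolding G_def by (auto intro: PiE_ext)
    qed
    show "finite (latin_cubes (2 * m))"
      unfolding latin_cubes_def by (rule finite_subset[of _ "box (2 * m) \<rightarrow>\<^sub>E {..<2 * m}"]) (auto intro: finite_PiE)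
  qed
  ultimately show ?thesis by (simp add: m_def)
qed

section \<open>Latin cubes inside designs\<close>

definition cube_block :: "nat \<Rightarrow> (nat \<times> nat \<times> nat \<Rightarrow> nat) \<Rightarrow> nat \<times> nat \<times> nat \<Rightarrow> nat set" where
  "cube_block q f = (\<lambda>(a, b, c). {a, q + b, 2 * q + c, 3 * q + f (a, b, c)})"

text \<open>Quotients by \<open>q\<close> label four groups of \<open>q\<close> points, and these
  are the triples covered by a transversal design of strength 3. They are the same for every Latin
  cube of order \<open>q\<close>, which permits the exchange.\<close>

definition cube_triples :: "nat \<Rightarrow> nat set set" where
  "cube_triples q = triples {..<4 * q} \<inter> {T. inj_on (\<lambda>x. x div q) T}"

lemma mem_4_parts:
  fixes a b c d q :: nat
  assumes "a < q" "b < q" "c < q" "d < q" "x < q"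
  shows "x \<in> {a, q + b, 2 * q + c, 3 * q + d} \<longleftrightarrow> x = a"
    and "q + x \<in> {a, q + b, 2 * q + c, 3 * q + d} \<longleftrightarrow> x = b"
    and "2 * q + x \<in> {a, q + b, 2 * q + c, 3 * q + d} \<longleftrightarrow> x = c"
    and "3 * q + x \<in> {a, q + b, 2 * q + c, 3 * q + d} \<longleftrightarrow> x = d"
  using assms by auto

text \<open>An injective map of the finite set \<open>{..<q}\<close> into itself is onto.\<close>

lemma latin_cube_solve:
  assumes f: "latin_cube q f" and "x < q" "y < q" "d < q"
  shows "\<exists>!a. a < q \<and> f (a, x, y) = d" "\<exists>!b. b < q \<and> f (x, b, y) = d" "\<exists>!c. c < q \<and> f (x, y, c) = d"
proof -
  have solve: "\<exists>!z. z < q \<and> h z = d" if "inj_on h {..<q}" "\<And>z. z < q \<Longrightarrow> h z < q" for h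
  proof -
    have "h ` {..<q} = {..<q}" by (rule endo_inj_surj) (use that in auto)
    then have "d \<in> h ` {..<q}" using \<open>d < q\<close> by simp
    then show ?thesis using that(1) by (auto simp: inj_on_def)
  qed
  show "\<exists>!a. a < q \<and> f (a, x, y) = d"
    by (rule solve) (use assms in \<open>simp_all add: latin_cube_def\<close>)
  show "\<exists>!b. b < q \<and> f (x, b, y) = d"
    by (rule solve) (use assms in \<open>simp_all add: latin_cube_def\<close>)
  show "\<exists>!c. c < q \<and> f (x, y, c) = d"
    by (rule solve) (use assms in \<open>simp_all add: latin_cube_def\<close>)
qed

lemma div_eq_imp_less:
  fixes x i q :: nat
  assumes "x div q = i" "0 < q"
  obtains y where "x = i * q + y" "y < q"
  by (rule that[of "x mod q"]) (use assms in auto)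

lemma cube_triples_cases:
  assumes "T \<in> cube_triples q" "0 < q"
  obtains a b c where "T = {a, q + b, 2 * q + c}" "a < q" "b < q" "c < q"
  | a b d where "T = {a, q + b, 3 * q + d}" "a < q" "b < q" "d < q"
  | a c d where "T = {a, 2 * q + c, 3 * q + d}" "a < q" "c < q" "d < q"
  | b c d where "T = {q + b, 2 * q + c, 3 * q + d}" "b < q" "c < q" "d < q"
proof -
  have T: "card T = 3" "T \<subseteq> {..<4 * q}" "inj_on (\<lambda>x. x div q) T"
    using assms by (auto simp: cube_triples_def triples_def)
  obtain x y z where xyz: "T = {x, y, z}" "x < y" "y < z" using T(1) by (rule sorted_triple)
  have "x div q \<noteq> y div q" "y div q \<noteq> z div q"
    using T(3) xyz by (auto simp: inj_on_def)
  then have less: "x div q < y div q" "y div q < z div q"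
    using xyz div_le_mono[of x y q] div_le_mono[of y z q] by auto
  have z4: "z div q < 4" using T(2) xyz by (simp add: less_mult_imp_div_less)
  obtain a where a: "x = (x div q) * q + a" "a < q" using div_eq_imp_less[OF refl assms(2)] .
  obtain b where b: "y = (y div q) * q + b" "b < q" using div_eq_imp_less[OF refl assms(2)] .
  obtain c where c: "z = (z div q) * q + c" "c < q" using div_eq_imp_less[OF refl assms(2)] .
  consider "x div q = 0" "y div q = 1" "z div q = 2" | "x div q = 0" "y div q = 1" "z div q = 3"
    | "x div q = 0" "y div q = 2" "z div q = 3" | "x div q = 1" "y div q = 2" "z div q = 3"
    using less z4 by linarith
  then show thesis
  proof cases
    case 1
    then have "x = a" "y = q + b" "z = 2 * q + c" using a b c by simp_all
    then show thesis using that(1) a b c xyz by metis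
  next
    case 2
    then have "x = a" "y = q + b" "z = 3 * q + c" using a b c by simp_all
    then show thesis using that(2) a b c xyz by metis
  next
    case 3
    then have "x = a" "y = 2 * q + b" "z = 3 * q + c" using a b c by simp_all
    then show thesis using that(3) a b c xyz by metis
  next
    case 4
    then have "x = q + a" "y = 2 * q + b" "z = 3 * q + c" using a b c by simp_all
    then show thesis using that(4) a b c xyz by metis
  qed
qed

lemma cube_block_transversal:
  assumes f: "latin_cube q f" and B: "B \<in> cube_block q f ` box q"
  shows "card B = 4" "B \<subseteq> {..<4 * q}" "inj_on (\<lambda>x. x div q) B"
proof -
  obtain a b c where B: "B = {a, q + b, 2 * q + c, 3 * q + f (a, b, c)}"
    and abc: "a < q" "b < q" "c < q" using B by (auto simp: cube_block_def)
  have d: "f (a, b, c) < q" using f abc by (simp add: latin_cube_def)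
  have "a div q = 0" "(q + b) div q = 1" "(2 * q + c) div q = 2" "(3 * q + f (a, b, c)) div q = 3"
    using abc d by simp_all
  then show "inj_on (\<lambda>x. x div q) B" unfolding B by (simp add: inj_on_def)
  show "card B = 4" unfolding B using abc by simp
  show "B \<subseteq> {..<4 * q}" unfolding B using abc d by auto
qed

text \<open>A triple that misses the last group fixes all three coordinates of its cell. Any other
  triple fixes two coordinates and the entry, and the Latin property yields the third
  coordinate.\<close>

lemma exact_cover_latin_cube:
  assumes f: "latin_cube q f" and "0 < q"
  shows "exact_cover (cube_block q f ` box q) (cube_triples q)"
proof (rule exact_coverI)
  have less: "f (a, b, c) < q" if "a < q" "b < q" "c < q" for a b c
    using f that by (simp add: latin_cube_def)
  note mem = mem_4_parts[OF _ _ _ less]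
  fix T assume T: "T \<in> cube_triples q"
  then show "card T = 3" by (simp add: cube_triples_def triples_def)
  \<comment> \<open>Uniqueness of the block is reduced to uniqueness of the one coordinate
    \<open>z\<close> of the cell that \<open>T\<close> leaves open.\<close>
  have ex1: "\<exists>!B. B \<in> cube_block q f ` box q \<and> T \<subseteq> B"
    if iff: "\<And>p. p \<in> box q \<and> T \<subseteq> cube_block q f p \<longleftrightarrow> (\<exists>z. p = h z \<and> R z)" and "\<exists>!z. R z"
    for h :: "nat \<Rightarrow> nat \<times> nat \<times> nat" and R
  proof -
    from \<open>\<exists>!z. R z\<close> obtain z where z: "R z" "\<forall>z'. R z' \<longrightarrow> z' = z" by (rule ex1E)
    have hz: "p \<in> box q \<and> T \<subseteq> cube_block q f p \<longleftrightarrow> p = h z" for p using iff[of p] z by metis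
    show ?thesis
    proof (rule ex1I[of _ "cube_block q f (h z)"])
      show "cube_block q f (h z) \<in> cube_block q f ` box q \<and> T \<subseteq> cube_block q f (h z)"
        using hz[of "h z"] by (metis imageI)
      fix B assume B: "B \<in> cube_block q f ` box q \<and> T \<subseteq> B"
      from conjunct1[OF B] obtain p where p: "B = cube_block q f p" "p \<in> box q" by (rule imageE)
      have "p = h z" by (rule iffD1[OF hz]) (use p B in simp)
      then show "B = cube_block q f (h z)" using p(1) by simp
    qed
  qed
  from T \<open>0 < q\<close> show "\<exists>!B. B \<in> cube_block q f ` box q \<and> T \<subseteq> B"
  proof (cases rule: cube_triples_cases)
    case (1 a b c)
    \<comment> \<open>No coordinate is open here, so \<open>z\<close> is a dummy fixed to 0.\<close>
    have "p \<in> box q \<and> T \<subseteq> cube_block q f p \<longleftrightarrow> (\<exists>z. p = (a, b, c) \<and> z = 0)" for p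
      using 1(2-4) by (cases p) (auto simp: 1(1) cube_block_def mem simp del: insert_iff)
    then show ?thesis by (rule ex1) simp
  next
    case (2 a b d)
    have "p \<in> box q \<and> T \<subseteq> cube_block q f p \<longleftrightarrow>
        (\<exists>c. p = (a, b, c) \<and> c < q \<and> f (a, b, c) = d)" for p
      using 2(2-4) by (cases p) (auto simp: 2(1) cube_block_def mem simp del: insert_iff)
    from this latin_cube_solve(3)[OF f 2(2-4)] show ?thesis by (rule ex1)
  next
    case (3 a c d)
    have "p \<in> box q \<and> T \<subseteq> cube_block q f p \<longleftrightarrow>
        (\<exists>b. p = (a, b, c) \<and> b < q \<and> f (a, b, c) = d)" for p
      using 3(2-4) by (cases p) (auto simp: 3(1) cube_block_def mem simp del: insert_iff)
    from this latin_cube_solve(2)[OF f 3(2-4)] show ?thesis by (rule ex1)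
  next
    case (4 b c d)
    have "p \<in> box q \<and> T \<subseteq> cube_block q f p \<longleftrightarrow>
        (\<exists>a. p = (a, b, c) \<and> a < q \<and> f (a, b, c) = d)" for p
      using 4(2-4) by (cases p) (auto simp: 4(1) cube_block_def mem simp del: insert_iff)
    from this latin_cube_solve(1)[OF f 4(2-4)] show ?thesis by (rule ex1)
  qed
next
  fix B assume B: "B \<in> cube_block q f ` box q"
  show "card B = 4 \<or> card B = 6" using cube_block_transversal[OF f B] by simp
  show "T \<in> cube_triples q" if "T \<subseteq> B" "card T = 3" for T
    using cube_block_transversal[OF f B] that
    by (auto simp: cube_triples_def triples_def dest: inj_on_subset)
qed

section \<open>XOR cubes inside designs\<close>

definition xor_cube :: "nat \<times> nat \<times> nat \<Rightarrow> nat" where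
  "xor_cube = (\<lambda>(a, b, c). a XOR b XOR c)"

lemma latin_cube_xor: "latin_cube (2 ^ k) xor_cube"
  using latin_cube_xor_shift[of "2 ^ k" k "\<lambda>_. 0"] by (simp add: xor_cube_def)

text \<open>The blocks of \<open>f0\<close> are exchanged for those of \<open>f\<close>. The new
  blocks are recovered from the result as those containing a triple of
  \<open>cube_triples q\<close>, and they determine \<open>f\<close>.\<close>

lemma card_latin_cubes_le_card_S3_46:
  assumes D: "is_S3_46 {..<v} \<B>" and f0: "latin_cube q f0" "0 < q" "cube_block q f0 ` box q \<subseteq> \<B>"
  shows "card (latin_cubes q) \<le> card (S3_46 {..<v})"
proof (rule card_inj_on_le)
  let ?C = "\<lambda>f. cube_block q f ` box q"
  note E = D[unfolded is_S3_46_iff_exact_cover]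
  define \<Phi> where "\<Phi> f = \<B> - ?C f0 \<union> ?C f" for f
  have cover: "exact_cover (?C f) (cube_triples q)" if "f \<in> latin_cubes q" for f
    using that f0(2) exact_cover_latin_cube by (simp add: latin_cubes_def)
  have cover0: "exact_cover (?C f0) (cube_triples q)" using f0 exact_cover_latin_cube by simp
  show "\<Phi> ` latin_cubes q \<subseteq> S3_46 {..<v}"
    using exact_cover_trade[OF E cover0 cover f0(3)]
    by (auto simp: \<Phi>_def S3_46_def is_S3_46_iff_exact_cover)
  show "inj_on \<Phi> (latin_cubes q)"
  proof (rule inj_onI)
    fix f g assume f: "f \<in> latin_cubes q" and g: "g \<in> latin_cubes q" and eq: "\<Phi> f = \<Phi> g"
    \<comment> \<open>Such a triple already lies in a block of \<open>?C f0\<close>, and the design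
      contains only one block through it.\<close>
    have untouched: "\<not> T \<subseteq> B" if B: "B \<in> \<B> - ?C f0" and T: "T \<in> cube_triples q" for B T
    proof
      assume "T \<subseteq> B"
      obtain B0 where B0: "B0 \<in> ?C f0" "T \<subseteq> B0" using exact_cover_ex[OF cover0 T] by blast
      have "T \<in> triples {..<v}"
        using exact_coverD(4)[OF E _ B0(2) exact_coverD(1)[OF cover0 T]] B0(1) f0(3) by blast
      then have "B = B0"
        using exact_cover_unique[OF E _ _ \<open>T \<subseteq> B\<close> _ B0(2)] B B0(1) f0(3) by blast
      then show False using B B0 by simp
    qed
    have C_eq: "?C h = {B \<in> \<Phi> h. \<exists>T\<in>cube_triples q. T \<subseteq> B}" if h: "h \<in> latin_cubes q" for h
    proof -
      have "\<exists>T\<in>cube_triples q. T \<subseteq> B" if "B \<in> ?C h" for B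
      proof -
        have "3 \<le> card B" using exact_coverD(3)[OF cover[OF h] that] by auto
        then obtain T where "T \<subseteq> B" "card T = 3" by (rule obtain_subset_with_card_n)
        then show ?thesis using exact_coverD(4)[OF cover[OF h] that] by blast
      qed
      then show ?thesis using untouched unfolding \<Phi>_def by auto
    qed
    have C_eq': "?C f = ?C g" using C_eq[OF f] C_eq[OF g] eq by simp
    have less: "h p < q" if "h \<in> latin_cubes q" "p \<in> box q" for h p
      using that unfolding latin_cubes_def by blast
    have "f p = g p" if p: "p \<in> box q" for p
    proof -
      have "cube_block q f p \<in> ?C g" using p C_eq' by blast
      then obtain p' where p': "p' \<in> box q" "cube_block q f p = cube_block q g p'" by blast
      obtain a b c a' b' c' where abc: "p = (a, b, c)" "p' = (a', b', c')" by (metis prod_cases3)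
      have l: "a < q" "b < q" "c < q" "a' < q" "b' < q" "c' < q" using p p' abc by auto
      have e: "{a, q + b, 2 * q + c, 3 * q + f p} = {a', q + b', 2 * q + c', 3 * q + g p'}"
        using p'(2) by (simp add: cube_block_def abc)
      note mem = mem_4_parts[OF l(4-6) less[OF g p'(1)]]
      have "a = a'" "b = b'" "c = c'" "f p = g p'"
        using mem(1)[OF l(1)] mem(2)[OF l(2)] mem(3)[OF l(3)] mem(4)[OF less[OF f p]]
        unfolding e[symmetric] by simp_all
      then show ?thesis using abc by simp
    qed
    then show "f = g" using f g unfolding latin_cubes_def by (auto intro: PiE_ext)
  qed
  have "S3_46 {..<v} \<subseteq> Pow (Pow {..<v})" unfolding S3_46_def is_S3_46_def by auto
  then show "finite (S3_46 {..<v})" by (rule finite_subset) simp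
qed

text \<open>Halving commutes with XOR, so the halved coordinates form a block of the smaller cube.
  The lowest bits of the four coordinates have an even sum, which is the parity condition on
  transversals.\<close>

lemma xor_cube_doubling:
  assumes q: "q = 2 ^ k"
    and B: "\<And>H. H \<in> cube_block q xor_cube ` box q \<Longrightarrow> even_transversals H \<subseteq> \<B>"
  shows "cube_block (2 * q) xor_cube ` box (2 * q) \<subseteq> \<B>"
proof (rule image_subsetI)
  fix p assume "p \<in> box (2 * q)"
  then obtain a b c where p: "p = (a, b, c)" "a < 2 * q" "b < 2 * q" "c < 2 * q" by auto
  define d where "d = a XOR b XOR c"
  have "d < 2 ^ Suc k" using p unfolding d_def q by (intro xor_less_pow2) auto
  then have d: "d < 2 * q" by (simp add: q)
  let ?U = "{a, 2 * q + b, 4 * q + c, 6 * q + d}"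
  let ?p = "(a div 2, b div 2, c div 2)"
  have U: "cube_block (2 * q) xor_cube p = ?U" by (simp add: p cube_block_def xor_cube_def d_def)
  have "xor_cube ?p = d div 2"
    unfolding xor_cube_def d_def using drop_bit_xor[of 1 a "b XOR c"] drop_bit_xor[of 1 b c]
    by (simp add: drop_bit_eq_div)
  then have H: "cube_block q xor_cube ?p = {a div 2, q + b div 2, 2 * q + c div 2, 3 * q + d div 2}"
    by (simp add: cube_block_def)
  have img: "(2 * q + b) div 2 = q + b div 2"
    "(4 * q + c) div 2 = 2 * q + c div 2" "(6 * q + d) div 2 = 3 * q + d div 2"
    by simp_all
  have "?U \<in> even_transversals (cube_block q xor_cube ?p)"
    unfolding even_transversals_def
  proof (intro CollectI conjI)
    show "?U \<subseteq> dbl (cube_block q xor_cube ?p)" unfolding H dbl_def by (simp add: img)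
    have less: "a div 2 < q" "b div 2 < q" "c div 2 < q" "d div 2 < q" using p d by auto
    show "transversal ?U" unfolding transversal_def using less by (auto simp: inj_on_def img)
    show "card ?U = 4" using p d by simp
    have "\<Sum>?U = a + b + c + d + 12 * q" using p d by simp
    then show "even (\<Sum>?U)" by (auto simp: d_def even_xor_iff)
  qed
  moreover have "?p \<in> box q" using p by auto
  then have "even_transversals (cube_block q xor_cube ?p) \<subseteq> \<B>" by (intro B imageI)
  ultimately show "cube_block (2 * q) xor_cube p \<in> \<B>" unfolding U by (rule rev_subsetD)
qed

text \<open>The bound \<open>n \<le> 6 * 2 ^ k\<close> says that the cube occupies at least a third
  of the points. The strict bound keeps the last point outside the cube, so that the next doubling
  may delete it.\<close>

lemma ex_S3_46_xor_cube:
  assumes "4 \<le> n"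
  shows "\<exists>\<B> k. is_S3_46 {..<2 * n} \<B> \<and> cube_block (2 ^ k) xor_cube ` box (2 ^ k) \<subseteq> \<B> \<and>
    4 * 2 ^ k < 2 * n \<and> n \<le> 6 * 2 ^ k"
  using assms
proof (induction n rule: less_induct)
  case (less n)
  have one: "cube_block (2 ^ 0) xor_cube ` box (2 ^ 0) = {{..<4}}"
  proof -
    have "box (2 ^ 0) = {(0, 0, 0)}" by auto
    moreover have "{0, Suc 0, Suc (Suc 0), 3} = {..<4}" by auto
    ultimately show ?thesis by (simp add: cube_block_def xor_cube_def)
  qed
  have small: "\<exists>\<B>. is_S3_46 {..<2 * n} \<B> \<and> {..<4} \<in> \<B>" if n: "n = 4 \<or> n = 6"
  proof -
    have "is_S3_46 {..<n} {{..<n}}"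
      unfolding is_S3_46_iff_exact_cover by (rule exact_cover_single) (use n in auto)
    then obtain \<B> where "is_S3_46 {..<2 * n} \<B>"
      and B: "\<And>F. F \<subseteq> {..<n} \<Longrightarrow> card F = 2 \<Longrightarrow> dbl F \<in> \<B>" by (rule doubling_same) blast
    moreover have "{..<2} \<subseteq> {..<n}" using n by auto
    then have "dbl {..<2} \<in> \<B>" by (rule B) simp
    then have "{..<4} \<in> \<B>" by (simp add: dbl_lessThan)
    ultimately show ?thesis by blast
  qed
  \<comment> \<open>From 7 on, half of \<open>n\<close> or of \<open>n + 1\<close> is at least 4 and
    less than \<open>n\<close>. The values 4, 5, 6 are base cases, with a cube of order 1, that is,
    the block \<open>{0, 1, 2, 3}\<close>.\<close>
  consider "n = 4 \<or> n = 6" | "n = 5" | "7 \<le> n" "even n" | "7 \<le> n" "odd n"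
    using less.prems by linarith
  then show ?case
  proof cases
    case 1
    then obtain \<B> where "is_S3_46 {..<2 * n} \<B>" "{..<4} \<in> \<B>" using small by blast
    moreover have "4 * 2 ^ 0 < 2 * n" "n \<le> 6 * 2 ^ 0" using 1 by auto
    ultimately show ?thesis using one by (metis empty_subsetI insert_subset)
  next
    case 2
    have "[0, 1, 2, 3] \<in> set sqs10" by (simp add: sqs10_def)
    then have "set [0, 1, 2, 3] \<in> set ` set sqs10" by (rule imageI)
    moreover have "set [0, 1, 2, 3] = {..<4::nat}" by auto
    moreover have "is_S3_46 {..<10} (set ` set sqs10)"
      using exact_cover_sqs10 by (simp add: is_S3_46_iff_exact_cover)
    ultimately have "is_S3_46 {..<2 * n} (set ` set sqs10)" "{..<4} \<in> set ` set sqs10"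
      using 2 by simp_all
    moreover have "4 * 2 ^ 0 < 2 * n" "n \<le> 6 * 2 ^ 0" using 2 by auto
    ultimately show ?thesis using one by (metis empty_subsetI insert_subset)
  next
    case 3
    then obtain m where m: "n = 2 * m" by blast
    have "\<exists>\<A> k. is_S3_46 {..<2 * m} \<A> \<and> cube_block (2 ^ k) xor_cube ` box (2 ^ k) \<subseteq> \<A> \<and>
        4 * 2 ^ k < 2 * m \<and> m \<le> 6 * 2 ^ k"
      by (rule less.IH) (use 3 m in auto)
    then obtain \<A> k where A: "is_S3_46 {..<n} \<A>" "cube_block (2 ^ k) xor_cube ` box (2 ^ k) \<subseteq> \<A>"
      and k: "4 * 2 ^ k < n" "n \<le> 12 * 2 ^ k"
      unfolding m by auto
    obtain \<B> where B: "is_S3_46 {..<2 * n} \<B>"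
      "\<And>H. H \<in> \<A> \<Longrightarrow> card H = 4 \<Longrightarrow> even_transversals H \<subseteq> \<B>"
      using A(1) by (rule doubling_same) blast
    have "cube_block (2 ^ Suc k) xor_cube ` box (2 ^ Suc k) \<subseteq> \<B>"
      unfolding power_Suc
    proof (rule xor_cube_doubling[OF refl])
      fix H assume H: "H \<in> cube_block (2 ^ k) xor_cube ` box (2 ^ k)"
      show "even_transversals H \<subseteq> \<B>"
        using B(2) A(2) H cube_block_transversal(1)[OF latin_cube_xor H] by blast
    qed
    moreover have "4 * 2 ^ Suc k < 2 * n" "n \<le> 6 * 2 ^ Suc k" using k by auto
    ultimately show ?thesis using B(1) by blast
  next
    case 4
    then obtain m where m: "Suc n = 2 * m" by (metis even_Suc evenE)
    have "\<exists>\<A> k. is_S3_46 {..<2 * m} \<A> \<and> cube_block (2 ^ k) xor_cube ` box (2 ^ k) \<subseteq> \<A> \<and>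
        4 * 2 ^ k < 2 * m \<and> m \<le> 6 * 2 ^ k"
      by (rule less.IH) (use 4 m in auto)
    then obtain \<A> k where A: "is_S3_46 {..<Suc n} \<A>" "cube_block (2 ^ k) xor_cube ` box (2 ^ k) \<subseteq> \<A>"
      and k: "4 * 2 ^ k < Suc n" "Suc n \<le> 12 * 2 ^ k"
      unfolding m by auto
    obtain \<B> where B: "is_S3_46 {..<2 * n} \<B>"
      "\<And>H. H \<in> \<A> \<Longrightarrow> n \<notin> H \<Longrightarrow> card H = 4 \<Longrightarrow> even_transversals H \<subseteq> \<B>"
      using A(1) by (rule doubling_delete) blast
    have "cube_block (2 ^ Suc k) xor_cube ` box (2 ^ Suc k) \<subseteq> \<B>"
      unfolding power_Suc
    proof (rule xor_cube_doubling[OF refl])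
      fix H assume H: "H \<in> cube_block (2 ^ k) xor_cube ` box (2 ^ k)"
      \<comment> \<open>The cube uses only points below \<open>4 * 2 ^ k\<close>, which is at most
        \<open>n\<close>, so its blocks survive the deletion.\<close>
      have "n \<notin> H" using cube_block_transversal(2)[OF latin_cube_xor H] k(1) by auto
      then show "even_transversals H \<subseteq> \<B>"
        using B(2) A(2) H cube_block_transversal(1)[OF latin_cube_xor H] by blast
    qed
    \<comment> \<open>Oddness of \<open>n\<close> restores the strict inequality that is lost in
      passing from \<open>Suc n\<close> to \<open>n\<close>.\<close>
    moreover have "n \<noteq> 4 * 2 ^ k" using 4(2) by auto
    then have "4 * 2 ^ Suc k < 2 * n" "n \<le> 6 * 2 ^ Suc k" using k by auto
    ultimately show ?thesis using B(1) by blast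
  qed
qed

text \<open>The number 192 is \<open>6 * 32\<close>, from \<open>n \<le> 6 * 2 ^ k\<close> and
  \<open>2 ^ k = 32 * r\<close>. For \<open>n\<close> at least \<open>192 ^ 2\<close>, the square of
  \<open>x = n / 192\<close> is at least \<open>n\<close>, so the logarithm loses only a factor 2;
  the other factor 2 in the constant gives strictness.\<close>

lemma ln_gt_if_self_power_le:
  fixes n r N :: nat
  assumes n: "192 ^ 2 \<le> n" and N: "r ^ (r ^ 3) \<le> N" and r: "n \<le> 192 * r"
  shows "ln (real N) > 1 / (4 * 192 ^ 3) * real n ^ 3 * ln (real n)"
proof -
  define x where "x = real n / 192"
  have x: "192 \<le> x" using n by (simp add: x_def power2_eq_square)
  have xr: "x \<le> real r" using r by (simp add: x_def)
  have "real n = x * 192" by (simp add: x_def)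
  also have "\<dots> \<le> x * x" using x by (intro mult_left_mono) auto
  finally have "ln (real n) \<le> ln (x * x)" using n by (subst ln_le_cancel_iff) (use x in auto)
  also have "\<dots> = 2 * ln x" using x by (simp add: ln_mult)
  finally have lnx: "ln (real n) / 2 \<le> ln x" by simp
  have pos: "0 < ln (real n)" using n by simp
  have "1 / (4 * 192 ^ 3) * real n ^ 3 * ln (real n) = x ^ 3 * (ln (real n) / 4)"
    by (simp add: x_def power_divide)
  also have "\<dots> < x ^ 3 * (ln (real n) / 2)" using x pos by simp
  also have "\<dots> \<le> x ^ 3 * ln x" using lnx x by (intro mult_left_mono) auto
  also have "\<dots> \<le> real r ^ 3 * ln (real r)"
    using x xr by (intro mult_mono power_mono) auto
  also have "\<dots> = ln (real (r ^ (r ^ 3)))" using x xr by (simp add: ln_realpow)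
  also have "\<dots> \<le> ln (real N)"
  proof -
    have "0 < r ^ (r ^ 3)" using x xr by simp
    moreover from this have "0 < N" using N by (rule less_le_trans)
    ultimately show ?thesis using N by (simp only: ln_le_cancel_iff of_nat_0_less_iff of_nat_le_iff)
  qed
  finally show ?thesis .
qed

theorem theorem4:
  shows "\<exists>c::real. c > 0 \<and> (\<exists>n0::nat. \<forall>n\<ge>n0.
           ln (real (card (S3_46 {..<2*n}))) > c * real n ^ 3 * ln (real n))"
proof (intro exI conjI allI impI)
  show "(0::real) < 1 / (4 * 192 ^ 3)" by simp
  fix n :: nat
  assume n: "192 ^ 2 \<le> n"
  then have "4 \<le> n" by simp
  then obtain \<B> k where D: "is_S3_46 {..<2 * n} \<B>" "cube_block (2 ^ k) xor_cube ` box (2 ^ k) \<subseteq> \<B>"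
    and k: "n \<le> 6 * 2 ^ k"
    using ex_S3_46_xor_cube by blast
  \<comment> \<open>This allows the factor 32 to be split off; a smaller exponent would give
    \<open>n \<le> 6 * 2 ^ 5 = 192\<close>.\<close>
  have "5 \<le> k"
  proof (rule ccontr)
    assume "\<not> 5 \<le> k"
    then have "(2::nat) ^ k \<le> 2 ^ 5" by (intro power_increasing) auto
    then show False using k n by simp
  qed
  then obtain j where j: "k = 5 + j" using le_Suc_ex by blast
  define r :: nat where "r = 2 ^ j"
  have q: "2 ^ k = 32 * r" by (simp add: j r_def power_add)
  have "r ^ (r ^ 3) \<le> card (latin_cubes (32 * r))" by (rule card_latin_cubes_ge[OF r_def])
  also have "\<dots> \<le> card (S3_46 {..<2 * n})"
    using card_latin_cubes_le_card_S3_46[OF D(1) latin_cube_xor zero_less_power D(2)]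
    by (simp only: q zero_less_numeral)
  finally have "r ^ (r ^ 3) \<le> card (S3_46 {..<2 * n})" .
  then show "1 / (4 * 192 ^ 3) * real n ^ 3 * ln (real n) < ln (real (card (S3_46 {..<2 * n})))"
    by (rule ln_gt_if_self_power_le[OF n]) (use k q in simp)
qed

end
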